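(* Assume that $\lambda_1(t)<\lambda_2(t)$ for every $t\in I$. For $t\in I$ write $\lambda=\lambda_1(t)$, $\phi_t=u_1(t)$, let $\dot\lambda$ and $\ddot\lambda$ be the first and second derivatives of $\lambda_1$ at $t$, and put $$\dot A=\dot A_t(\phi_t,\phi_t),\quad \ddot A=\ddot A_t(\phi_t,\phi_t),\quad \dot B=\dot B_t(\phi_t,\phi_t),\quad \ddot B=\ddot B_t(\phi_t,\phi_t).$$ Then $$\dot\lambda=\dot A-\lambda\dot B,\qquad \ddot\lambda\le \ddot A-\lambda\ddot B-2\dot\lambda\dot B .$$
   Context: Let $(X,|\cdot|)$ and $(V,\|\cdot\|)$ be real Hilbert spaces with compact embedding $V\hookrightarrow X$; $V$ is infinite dimensional and dense in $X$. Let $I=(-\varepsilon_0,\varepsilon_0)$, $\varepsilon_0>0$. For $t\in I$ let $A_t:V\times V\to\mathbb{R}$ and $B_t:X\times X\to\mathbb{R}$ be symmetric bilinear forms for which there are constants $C,\delta>0$ independent of $t$ with $$|A_t(u,v)|\le C\|u\|\|v\|,\quad A_t(u,u)\ge\delta\|u\|^2\quad (u,v\in V),$$ $$|B_t(u,v)|\le C|u||v|,\quad B_t(u,u)\ge\delta|u|^2\quad (u,v\in X).$$ Consider the eigenvalue problem: $u\in V$, $B_t(u,u)=1$, $A_t(u,v)=\lambda B_t(u,v)$ for all $v\in V$. Its eigenvalues, counted with multiplicity, are $0<\lambda_1(t)\le\lambda_2(t)\le\cdots\to+\infty$, with eigenfunctions $u_1(t),u_2(t),\dots$ forming a complete orthonormal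 system in $X$ with respect to the inner product $B_t$. Standing differentiability assumptions: for every $t\in I$ there are bilinear forms $\dot A_t,\ddot A_t:V\times V\to\mathbb{R}$ and $\dot B_t,\ddot B_t:X\times X\to\mathbb{R}$ such that, with $C$ independent of $t$, $$|\dot A_t(u,v)|,\ |\ddot A_t(u,v)|\le C\|u\|\|v\|\ (u,v\in V),\qquad |\dot B_t(u,v)|,\ |\ddot B_t(u,v)|\le C|u||v|\ (u,v\in X),$$ and, for every $t\in I$, $$\lim_{h\to0}\tfrac1h\sup_{\|u\|,\|v\|\le1}|(A_{t+h}-A_t-h\dot A_t)(u,v)|=0,\qquad \lim_{h\to0}\tfrac1h\sup_{|u|,|v|\le1}|(B_{t+h}-B_t-h\dot B_t)(u,v)|=0,$$ $$\lim_{h\to0}\tfrac1{h^2}\sup_{\|u\|,\|v\|\le1}|(A_{t+h}-A_t-h\dot A_t-\tfrac{h^2}{2}\ddot A_t)(u,v)|=0,\qquad \lim_{h\to0}\tfrac1{h^2}\sup_{|u|,|v|\le1}|(B_{t+h}-B_t-h\dot B_t-\tfrac{h^2}{2}\ddot B_t)(u,v)|=0,$$ $$\lim_{h\to0}\sup_{\|u\|,\|v\|\le1}|(\dot A_{t+h}-\dot A_t)(u,v)|=\lim_{h\to0}\sup_{\|u\|,\|v\|\le1}|(\ddot A_{t+h}-\ddot A_t)(u,v)|=0,$$ $$\lim_{h\to0}\sup_{|u|,|v|\le1}|(\dot B_{t+h}-\dot B_t)(u,v)|=\lim_{h\to0}\sup_{|u|,|v|\le1}|(\ddot B_{t+h}-\ddot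 B_t)(u,v)|=0.$$ Under these assumptions and $\lambda_1(t)<\lambda_2(t)$ for all $t\in I$, the function $\lambda_1$ is known to be of class $C^2$ on $I$. *)

theory Defs
  imports "HOL-Analysis.Analysis"
begin

text \<open>
  The inclusion of \<open>V\<close> into \<open>X\<close> is an explicit injective map \<open>\<iota>\<close>; a form \<open>b\<close> on \<open>X\<close> is
  evaluated on elements of \<open>V\<close> through \<open>\<iota>\<close>.
\<close>

definition compact_embedding :: "('v::real_normed_vector \<Rightarrow> 'x::real_normed_vector) \<Rightarrow> bool"
  where "compact_embedding \<iota> \<longleftrightarrow>
    bounded_linear \<iota> \<and> inj \<iota> \<and> compact (closure (\<iota> ` cball 0 1))"

definition infinite_dimensional :: "'a::real_vector itself \<Rightarrow> bool"
  where "infinite_dimensional _ \<longleftrightarrow> (\<nexists>S :: 'a set. finite S \<and> span S = UNIV)"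

definition symmetric_coercive_family ::
    "real set \<Rightarrow> (real \<Rightarrow> 'a::real_normed_vector \<Rightarrow> 'a \<Rightarrow> real) \<Rightarrow> bool"
  where "symmetric_coercive_family I F \<longleftrightarrow>
    (\<forall>t\<in>I. bilinear (F t) \<and> (\<forall>u v. F t u v = F t v u)) \<and>
    (\<exists>C>0. \<forall>t\<in>I. \<forall>u v. \<bar>F t u v\<bar> \<le> C * norm u * norm v) \<and>
    (\<exists>\<delta>>0. \<forall>t\<in>I. \<forall>u. F t u u \<ge> \<delta> * (norm u)\<^sup>2)"

text \<open>
  The supremum is taken in the reals, hence meaningful only for bounded \<open>g\<close>. For the families below
  it is applied only to such \<open>g\<close>, except when \<open>t + h \<notin> I\<close>, which does not affect limits at \<open>h = 0\<close>.
\<close>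

definition form_norm :: "('a::real_normed_vector \<Rightarrow> 'a \<Rightarrow> real) \<Rightarrow> real"
  where "form_norm g = (SUP (u, v) \<in> cball 0 1 \<times> cball 0 1. \<bar>g u v\<bar>)"

definition twice_differentiable_family ::
    "real set \<Rightarrow> (real \<Rightarrow> 'a::real_normed_vector \<Rightarrow> 'a \<Rightarrow> real) \<Rightarrow>
     (real \<Rightarrow> 'a \<Rightarrow> 'a \<Rightarrow> real) \<Rightarrow> (real \<Rightarrow> 'a \<Rightarrow> 'a \<Rightarrow> real) \<Rightarrow> bool"
  where "twice_differentiable_family I F F' F'' \<longleftrightarrow>
    (\<forall>t\<in>I. bilinear (F' t) \<and> bilinear (F'' t)) \<and>
    (\<exists>C>0. \<forall>t\<in>I. \<forall>u v. \<bar>F' t u v\<bar> \<le> C * norm u * norm v \<and>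
                        \<bar>F'' t u v\<bar> \<le> C * norm u * norm v) \<and>
    (\<forall>t\<in>I.
      ((\<lambda>h. form_norm (\<lambda>u v. F (t + h) u v - F t u v - h * F' t u v) / h) \<longlongrightarrow> 0) (at 0) \<and>
      ((\<lambda>h. form_norm (\<lambda>u v. F (t + h) u v - F t u v - h * F' t u v - h\<^sup>2 / 2 * F'' t u v) / h\<^sup>2)
         \<longlongrightarrow> 0) (at 0) \<and>
      ((\<lambda>h. form_norm (\<lambda>u v. F' (t + h) u v - F' t u v)) \<longlongrightarrow> 0) (at 0) \<and>
      ((\<lambda>h. form_norm (\<lambda>u v. F'' (t + h) u v - F'' t u v)) \<longlongrightarrow> 0) (at 0))"

definition normalized_eigenpair ::
    "('v \<Rightarrow> 'x) \<Rightarrow> ('v \<Rightarrow> 'v \<Rightarrow> real) \<Rightarrow> ('x \<Rightarrow> 'x \<Rightarrow> real) \<Rightarrow> real \<Rightarrow> 'v \<Rightarrow> bool"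
  where "normalized_eigenpair \<iota> a b \<mu> u \<longleftrightarrow>
    b (\<iota> u) (\<iota> u) = 1 \<and> (\<forall>v. a u v = \<mu> * b (\<iota> u) (\<iota> v))"

text \<open>
  Indices start at 0, so \<open>lam n\<close> and \<open>u n\<close> are the eigenvalue and eigenfunction usually numbered
  \<open>n + 1\<close>. The last clause is completeness in \<open>X\<close> (for bounded coercive \<open>b\<close> the norms induced by
  \<open>b\<close> and by \<open>X\<close> are equivalent). It forces every eigenvalue to occur in \<open>lam\<close> exactly as often as
  its multiplicity, since eigenfunctions of distinct eigenvalues are \<open>b\<close>-orthogonal.
\<close>

definition eigensystem ::
    "('v \<Rightarrow> 'x::real_normed_vector) \<Rightarrow> ('v \<Rightarrow> 'v \<Rightarrow> real) \<Rightarrow> ('x \<Rightarrow> 'x \<Rightarrow> real) \<Rightarrow>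
     (nat \<Rightarrow> real) \<Rightarrow> (nat \<Rightarrow> 'v) \<Rightarrow> bool"
  where "eigensystem \<iota> a b lam u \<longleftrightarrow>
    0 < lam 0 \<and> mono lam \<and> filterlim lam at_top sequentially \<and>
    (\<forall>n. normalized_eigenpair \<iota> a b (lam n) (u n)) \<and>
    (\<forall>m n. m \<noteq> n \<longrightarrow> b (\<iota> (u m)) (\<iota> (u n)) = 0) \<and>
    closure (span (range (\<lambda>n. \<iota> (u n)))) = UNIV"

end

theory Submission
  imports Defs
begin

text \<open>
  Pulled back to \<open>V\<close> along the embedding, all forms live on one space; write \<open>a\<close> and \<open>b\<close> for the two
  families, \<open>\<lambda>\<close> for the lowest eigenvalue and \<open>\<phi>\<^sub>t\<close> for the given eigenfunction at \<open>t\<close>. The form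
  \<open>a\<^sub>t - \<lambda>(t) b\<^sub>t\<close>, here called the defect, is nonnegative and vanishes on \<open>\<phi>\<^sub>t\<close>. Once \<open>\<lambda>\<close> is known to be
  twice differentiable, both assertions are the first and second order conditions for the function
  \<open>s \<mapsto> (a\<^sub>s - \<lambda>(s) b\<^sub>s)(\<phi>\<^sub>t, \<phi>\<^sub>t)\<close>, with \<open>\<phi>\<^sub>t\<close> held fixed, at its minimum \<open>s = t\<close>: its derivative there is
  zero and its second derivative is nonnegative (\<open>second_derivative_le\<close>).

  The regularity of \<open>\<lambda>\<close> rests on the spectral gap: by completeness of the eigenfunctions and
  \<open>\<lambda>\<^sub>1 < \<lambda>\<^sub>2\<close>, the defect is coercive in the norm of \<open>V\<close> on the complement of \<open>\<phi>\<^sub>t\<close>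
  (\<open>eigensystem_spectral_gap\<close>). The map \<open>s \<mapsto> \<phi>\<^sub>s\<close> itself need not be continuous, because nothing
  prevents sign changes. It is therefore replaced, near a fixed \<open>t\<close>, by the multiple \<open>\<psi>\<^sub>s\<close> of \<open>\<phi>\<^sub>s\<close>
  with \<open>b\<^sub>t(\<phi>\<^sub>t, \<psi>\<^sub>s) = 1\<close>, so that \<open>\<psi>\<^sub>s - \<phi>\<^sub>t\<close> lies in the complement where the gap applies.
  Evaluating the defect at \<open>t\<close> on \<open>\<phi>\<^sub>s\<close> shows that \<open>\<psi>\<^sub>s\<close> tends to \<open>\<phi>\<^sub>t\<close> in \<open>V\<close> (\<open>aligned_tendsto\<close>); testing
  the equation of \<open>\<psi>\<^sub>s\<close> with \<open>\<phi>\<^sub>t\<close> gives the first derivative of \<open>\<lambda>\<close> (\<open>DERIV_eigenvalue\<close>). The difference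
  quotients of \<open>\<psi>\<close> solve the linearised equation up to a small error, so the gap makes them Cauchy
  and completeness of \<open>V\<close> provides a derivative of \<open>\<psi>\<close> at \<open>t\<close> (\<open>aligned_differentiable\<close>). The formula
  for the derivative of \<open>\<lambda>\<close> does not see the scaling of the eigenfunction and may be written with
  \<open>\<psi>\<close>; hence it is differentiable once more (\<open>DERIV_lam'\<close>).

  This last step needs the derivative of \<open>A'\<close> and \<open>B'\<close>, while the assumptions only give second order
  Taylor expansions of \<open>A\<close> and \<open>B\<close>. A continuous second order Taylor coefficient is a genuine
  second derivative; this is a maximum principle for functions of one real variable, and it is
  uniform enough to hold in the norm of forms
  (\<open>twice_differentiable_family_form_has_second_derivative\<close>).
\<close>

section \<open>Second derivatives and Taylor coefficients of second order\<close>

text \<open>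
  Otherwise the affinely and quadratically corrected function \<open>G - (m - \<eta>) s\<^sup>2 / 2 - k s\<close> would, for
  some \<open>\<eta> > 0\<close> and a suitable slope \<open>k\<close>, rise at \<open>x\<close> and fall at \<open>y\<close>, and hence have an interior maximum.
  There its second order expansion has quadratic coefficient at least \<open>\<eta> / 2\<close>, which forces a strict
  local minimum instead.
\<close>

lemma peano_second_derivative_ge_imp_increment_ge:
  fixes G g p :: "real \<Rightarrow> real"
  assumes "x < y"
    and deriv: "\<And>s. s \<in> {x..y} \<Longrightarrow> (G has_real_derivative g s) (at s)"
    and peano: "\<And>s e. s \<in> {x..y} \<Longrightarrow> e > 0 \<Longrightarrow>
      \<forall>\<^sub>F r in at s. \<bar>G r - G s - (r - s) * g s - (r - s)\<^sup>2 / 2 * p s\<bar> \<le> e * (r - s)\<^sup>2"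
    and lower: "\<And>s. s \<in> {x..y} \<Longrightarrow> m \<le> p s"
  shows "m * (y - x) \<le> g y - g x"
proof (rule ccontr)
  assume neg: "\<not> m * (y - x) \<le> g y - g x"
  \<comment> \<open>half of the amount by which the mean slope of \<open>g\<close> falls short of \<open>m\<close>, so that \<open>h\<close> below
     still decreases from \<open>x\<close> to \<open>y\<close>\<close>
  define \<eta> where "\<eta> = (m * (y - x) - (g y - g x)) / (2 * (y - x))"
  have \<eta>: "\<eta> > 0" using neg \<open>x < y\<close> by (simp add: \<eta>_def)
  define h where "h s = g s - (m - \<eta>) * s" for s
  have "\<eta> * (y - x) = (m * (y - x) - (g y - g x)) / 2"
    using \<open>x < y\<close> by (simp add: \<eta>_def field_simps)
  then have hyx: "h y < h x" using neg by (simp add: h_def algebra_simps)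
  \<comment> \<open>any value strictly between \<open>h y\<close> and \<open>h x\<close> would do\<close>
  define k where "k = (h x + h y) / 2"
  define K where "K s = G s - (m - \<eta>) * s\<^sup>2 / 2 - k * s" for s
  have dK: "(K has_real_derivative h s - k) (at s)" if "s \<in> {x..y}" for s
    unfolding K_def h_def
    by (rule derivative_eq_intros deriv[OF that] refl | simp)+
  have "continuous_on {x..y} K"
    using dK DERIV_isCont continuous_at_imp_continuous_on by blast
  then obtain q where q: "q \<in> {x..y}" and qmax: "\<And>s. s \<in> {x..y} \<Longrightarrow> K s \<le> K q"
    using continuous_attains_sup[of "{x..y}" K] \<open>x < y\<close> by auto
  have "q \<noteq> x"
  proof
    assume "q = x"
    have "h x - k > 0" using hyx by (simp add: k_def)
    then obtain d where d: "d > 0" "\<And>h. 0 < h \<Longrightarrow> h < d \<Longrightarrow> K x < K (x + h)"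
      using DERIV_pos_inc_right[OF dK[of x]] \<open>x < y\<close> by auto
    define r where "r = min (d/2) (y - x)"
    have "K x < K (x + r)" "x + r \<in> {x..y}" using d \<open>x < y\<close> by (auto simp: r_def)
    then show False using qmax \<open>q = x\<close> by fastforce
  qed
  moreover have "q \<noteq> y"
  proof
    assume "q = y"
    have "h y - k < 0" using hyx by (simp add: k_def)
    then obtain d where d: "d > 0" "\<And>h. 0 < h \<Longrightarrow> h < d \<Longrightarrow> K y < K (y - h)"
      using DERIV_neg_dec_left[OF dK[of y]] \<open>x < y\<close> by auto
    define r where "r = min (d/2) (y - x)"
    have "K y < K (y - r)" "y - r \<in> {x..y}" using d \<open>x < y\<close> by (auto simp: r_def)
    then show False using qmax \<open>q = y\<close> by fastforce
  qed
  ultimately have qin: "x < q" "q < y" using q by auto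
  have "h q - k = 0"
  proof (rule DERIV_local_max[OF dK[OF q]])
    show "0 < min (q - x) (y - q)" using qin by simp
    show "\<forall>s. \<bar>q - s\<bar> < min (q - x) (y - q) \<longrightarrow> K s \<le> K q"
      using qmax by (auto simp: abs_if split: if_splits)
  qed
  then have k: "k = g q - (m - \<eta>) * q" by (simp add: h_def)
  have "\<forall>\<^sub>F r in at q. r \<in> {x<..<y}"
    using qin by (intro eventually_at_in_open') auto
  moreover have "\<forall>\<^sub>F r in at q. r \<noteq> q" by (simp add: eventually_at_filter)
  ultimately have "\<forall>\<^sub>F r in at q. False"
    using peano[OF q divide_pos_pos[OF \<eta> zero_less_numeral[of "num.Bit0 (num.Bit0 num.One)"]]]
  proof eventually_elim
    case (elim r)
    have "K r - K q = G r - G q - (r - q) * g q - (m * (r - q)\<^sup>2 - \<eta> * (r - q)\<^sup>2) / 2"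
      unfolding K_def k by (simp add: power2_eq_square field_simps)
    moreover have "(r - q)\<^sup>2 > 0" using elim by simp
    moreover have "m * (r - q)\<^sup>2 \<le> p q * (r - q)\<^sup>2"
      using lower[OF q] by (simp add: mult_right_mono)
    moreover have "\<eta> * (r - q)\<^sup>2 > 0" using \<eta> elim by simp
    moreover have "- (\<eta> * (r - q)\<^sup>2 / 4) \<le> G r - G q - (r - q) * g q - p q * (r - q)\<^sup>2 / 2"
      using abs_le_D2[OF elim(3)] by (simp add: field_simps)
    moreover have "0 < k" if "k = T - (mx - ex) / 2" "mx \<le> px" "0 < ex" "- (ex / 4) \<le> T - px / 2"
      for k T mx ex px :: real using that by simp
    ultimately have "K r - K q > 0" by blast
    with elim(1) qmax[of r] show False by simp
  qed
  then show False by (simp add: eventually_False)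
qed

text \<open>
  The bound on the increment is the given bound on the oscillation of \<open>p\<close> and does not involve the
  remainders of the expansions. Applied to \<open>G s = F s u v\<close> it therefore is uniform in \<open>u\<close> and \<open>v\<close>, although the expansions of \<open>G\<close> need not be
  uniform in the base point.
\<close>

lemma peano_second_derivative_increment:
  fixes G g p :: "real \<Rightarrow> real"
  assumes "x < y"
    and deriv: "\<And>s. s \<in> {x..y} \<Longrightarrow> (G has_real_derivative g s) (at s)"
    and peano: "\<And>s e. s \<in> {x..y} \<Longrightarrow> e > 0 \<Longrightarrow>
      \<forall>\<^sub>F r in at s. \<bar>G r - G s - (r - s) * g s - (r - s)\<^sup>2 / 2 * p s\<bar> \<le> e * (r - s)\<^sup>2"
    and close: "\<And>s. s \<in> {x..y} \<Longrightarrow> \<bar>p s - P\<bar> \<le> e"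
  shows "\<bar>g y - g x - (y - x) * P\<bar> \<le> e * (y - x)"
proof -
  have "(P - e) * (y - x) \<le> g y - g x"
    using close
    by (intro peano_second_derivative_ge_imp_increment_ge[OF \<open>x < y\<close> deriv peano]) fastforce+
  moreover have "(- P - e) * (y - x) \<le> - g y - (- g x)"
  proof (rule peano_second_derivative_ge_imp_increment_ge[where G = "\<lambda>s. - G s" and p = "\<lambda>s. - p s"])
    fix s d :: real assume "s \<in> {x..y}" "d > 0"
    from peano[OF this]
    show "\<forall>\<^sub>F r in at s. \<bar>- G r - - G s - (r - s) * - g s - (r - s)\<^sup>2 / 2 * - p s\<bar> \<le> d * (r - s)\<^sup>2"
      by eventually_elim (simp add: abs_le_iff algebra_simps)
  next
    fix s assume "s \<in> {x..y}"
    then show "- P - e \<le> - p s" using close[of s] by (simp add: abs_le_iff)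
  next
    fix s assume "s \<in> {x..y}"
    from DERIV_minus[OF deriv[OF this]]
    show "((\<lambda>s. - G s) has_real_derivative - g s) (at s)" .
  qed (rule \<open>x < y\<close>)
  ultimately show ?thesis by (simp add: abs_le_iff algebra_simps)
qed

lemma second_derivative_nonneg_at_local_min:
  fixes g :: "real \<Rightarrow> real"
  assumes d1: "\<forall>\<^sub>F s in nhds t. (g has_real_derivative g1 s) (at s)"
    and d2: "(g1 has_real_derivative g2) (at t)"
    and min: "\<forall>\<^sub>F s in nhds t. g t \<le> g s"
  shows "0 \<le> g2"
proof (rule ccontr)
  assume "\<not> 0 \<le> g2"
  then obtain d where d: "d > 0" "\<And>h. 0 < h \<Longrightarrow> h < d \<Longrightarrow> g1 (t + h) < g1 t"
    using DERIV_neg_dec_right[OF d2] by auto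
  obtain r where r: "r > 0" "\<And>s. dist s t < r \<Longrightarrow> (g has_real_derivative g1 s) (at s) \<and> g t \<le> g s"
    using eventually_conj[OF d1 min] unfolding eventually_nhds_metric by blast
  have "g1 t = 0"
    using r by (intro DERIV_local_min[of g "g1 t" t r]) (auto simp: dist_real_def abs_minus_commute)
  define h where "h = min d r / 2"
  have h: "0 < h" "h < d" "h < r" using d r by (auto simp: h_def)
  have D: "(g has_real_derivative g1 s) (at s)" if "t \<le> s" "s \<le> t + h" for s
    using r(2)[of s] that h by (auto simp: dist_real_def)
  have "g (t + h) < g t"
  proof (rule DERIV_neg_imp_decreasing_open[of t "t + h" g])
    fix s assume s: "t < s" "s < t + h"
    then show "\<exists>y. (g has_real_derivative y) (at s) \<and> y < 0"
      using D[of s] d(2)[of "s - t"] h \<open>g1 t = 0\<close> by auto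
  next
    show "continuous_on {t..t + h} g"
      using D by (intro continuous_at_imp_continuous_on ballI) (auto intro: DERIV_isCont)
  qed (use h in simp)
  moreover have "g t \<le> g (t + h)" using r(2)[of "t + h"] h by (simp add: dist_real_def)
  ultimately show False by simp
qed

section \<open>Differentiability of families of forms\<close>

lemma bounded_bilinear_diff:
  assumes "bounded_bilinear f" "bounded_bilinear g"
  shows "bounded_bilinear (\<lambda>u v. f u v - g u v)"
proof -
  interpret f: bounded_bilinear f by fact
  interpret g: bounded_bilinear g by fact
  obtain K where K: "\<And>u v. norm (f u v) \<le> norm u * norm v * K" using f.bounded by blast
  obtain L where L: "\<And>u v. norm (g u v) \<le> norm u * norm v * L" using g.bounded by blast
  show ?thesis
  proof
    show "\<exists>M. \<forall>u v. norm (f u v - g u v) \<le> norm u * norm v * M"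
    proof (intro exI allI)
      fix u v
      show "norm (f u v - g u v) \<le> norm u * norm v * (K + L)"
        using norm_triangle_ineq4[of "f u v" "g u v"] K[of u v] L[of u v]
        by (simp add: algebra_simps)
    qed
  qed (simp_all add: f.add_left f.add_right g.add_left g.add_right
        f.scaleR_left f.scaleR_right g.scaleR_left g.scaleR_right scaleR_diff_right)
qed

lemma bounded_bilinear_cmult:
  fixes f :: "'a::real_normed_vector \<Rightarrow> 'b::real_normed_vector \<Rightarrow> real"
  assumes "bounded_bilinear f"
  shows "bounded_bilinear (\<lambda>u v. c * f u v)"
proof -
  interpret f: bounded_bilinear f by fact
  obtain K where K: "\<And>u v. norm (f u v) \<le> norm u * norm v * K" using f.bounded by blast
  show ?thesis
  proof
    show "\<exists>M. \<forall>u v. norm (c * f u v) \<le> norm u * norm v * M"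
    proof (intro exI allI)
      fix u v
      show "norm (c * f u v) \<le> norm u * norm v * (\<bar>c\<bar> * K)"
        using mult_left_mono[OF K[of u v], of "\<bar>c\<bar>"] by (simp add: abs_mult algebra_simps)
    qed
  qed (simp_all add: f.add_left f.add_right f.scaleR_left f.scaleR_right algebra_simps)
qed

lemma bounded_bilinear_realI:
  fixes f :: "'a::real_normed_vector \<Rightarrow> 'b::real_normed_vector \<Rightarrow> real"
  assumes "bilinear f" "\<And>u v. \<bar>f u v\<bar> \<le> C * norm u * norm v"
  shows "bounded_bilinear f"
proof
  show "\<exists>K. \<forall>u v. norm (f u v) \<le> norm u * norm v * K"
    using assms(2) by (intro exI[of _ C]) (simp add: mult_ac)
qed (use assms(1) in \<open>simp_all add: bilinear_ladd bilinear_radd bilinear_lmul bilinear_rmul\<close>)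

lemma abs_le_form_norm:
  assumes "bounded_bilinear g"
  shows "\<bar>g u v\<bar> \<le> form_norm g * norm u * norm v"
proof -
  interpret g: bounded_bilinear g by fact
  obtain K where K: "K \<ge> 0" "\<And>u v. norm (g u v) \<le> norm u * norm v * K"
    using g.nonneg_bounded by blast
  have "bdd_above ((\<lambda>(u, v). \<bar>g u v\<bar>) ` (cball 0 1 \<times> cball 0 1))"
  proof (rule bdd_aboveI2)
    fix z assume "z \<in> (cball 0 1 :: 'a set) \<times> (cball 0 1 :: 'a set)"
    then obtain u v where z: "z = (u, v)" "norm u \<le> 1" "norm v \<le> 1" by auto
    then have "norm u * norm v * K \<le> 1 * 1 * K"
      using K(1) by (intro mult_right_mono mult_mono) auto
    then show "(case z of (u, v) \<Rightarrow> \<bar>g u v\<bar>) \<le> K" using K(2)[of u v] z by simp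
  qed
  from cSUP_upper[OF _ this, of "(sgn u, sgn v)"]
  have "\<bar>g (sgn u) (sgn v)\<bar> \<le> form_norm g"
    by (simp add: form_norm_def norm_sgn)
  then have "norm u * norm v * \<bar>g (sgn u) (sgn v)\<bar> \<le> norm u * norm v * form_norm g"
    by (intro mult_left_mono) auto
  moreover have "g u v = norm u * norm v * g (sgn u) (sgn v)"
  proof -
    have *: "w = norm w *\<^sub>R sgn w" for w :: 'a by (cases "w = 0") (simp_all add: sgn_div_norm)
    have "g u v = g (norm u *\<^sub>R sgn u) (norm v *\<^sub>R sgn v)" using *[of u] *[of v] by simp
    then show ?thesis by (simp only: g.scaleR_left g.scaleR_right) simp
  qed
  ultimately show ?thesis by (simp add: abs_mult mult_ac)
qed

text \<open>
  This is Frechet differentiability for the norm of forms, expressed by inequalities. Forms outside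
  the parameter interval need not be bounded, so they are not points of a normed space.
\<close>

definition form_has_derivative ::
    "(real \<Rightarrow> 'a::real_normed_vector \<Rightarrow> 'a \<Rightarrow> real) \<Rightarrow> ('a \<Rightarrow> 'a \<Rightarrow> real) \<Rightarrow> real \<Rightarrow> bool"
  where "form_has_derivative F D t \<longleftrightarrow>
    (\<forall>e>0. \<forall>\<^sub>F s in at t. \<forall>u v. \<bar>F s u v - F t u v - (s - t) * D u v\<bar> \<le> e * \<bar>s - t\<bar> * norm u * norm v)"

lemma twice_differentiable_family_bounded_bilinear:
  assumes "twice_differentiable_family I F F' F''" "t \<in> I"
  shows "bounded_bilinear (F' t)" "bounded_bilinear (F'' t)"
proof -
  obtain C where "\<forall>t\<in>I. \<forall>u v. \<bar>F' t u v\<bar> \<le> C * norm u * norm v \<and> \<bar>F'' t u v\<bar> \<le> C * norm u * norm v"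
    using assms(1) unfolding twice_differentiable_family_def by blast
  moreover have "bilinear (F' t)" "bilinear (F'' t)"
    using assms unfolding twice_differentiable_family_def by blast+
  ultimately show "bounded_bilinear (F' t)" "bounded_bilinear (F'' t)"
    using assms(2) by (auto intro: bounded_bilinear_realI[where C = C])
qed

lemma symmetric_coercive_family_bounded_bilinear:
  assumes "symmetric_coercive_family I F" "t \<in> I"
  shows "bounded_bilinear (F t)"
  using assms unfolding symmetric_coercive_family_def
  by (metis bounded_bilinear_realI)

text \<open>
  For a fixed parameter the supremum in the norm of forms is that of a bounded set, so limits of norms
  turn into estimates that hold for all arguments at once. The weight \<open>\<rho>\<close> covers expansions of first
  and second order and plain continuity.
\<close>

lemma form_norm_tendsto_imp_uniform:
  fixes t :: real
  assumes lim: "((\<lambda>h. form_norm (R h) / \<rho> h) \<longlongrightarrow> 0) (at 0)"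
    and \<rho>: "\<And>h. h \<noteq> 0 \<Longrightarrow> \<rho> h \<noteq> 0"
    and I: "open I" "t \<in> I" 
    and bil: "\<And>h. t + h \<in> I \<Longrightarrow> bounded_bilinear (R h)"
    and "e > (0::real)"
  shows "\<forall>\<^sub>F s in at t. \<forall>u v. \<bar>R (s - t) u v\<bar> \<le> e * \<bar>\<rho> (s - t)\<bar> * norm u * norm v"
proof -
  have "\<forall>\<^sub>F h in at 0. \<bar>form_norm (R h) / \<rho> h\<bar> < e"
    using tendstoD[OF lim \<open>e > 0\<close>] by simp
  then have "\<forall>\<^sub>F s in at t. \<bar>form_norm (R (s - t)) / \<rho> (s - t)\<bar> < e"
    by (simp add: at_to_0[of t] eventually_filtermap)
  moreover have "\<forall>\<^sub>F s in at t. s \<in> I" using I by (rule eventually_at_in_open')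
  moreover have "\<forall>\<^sub>F s in at t. s \<noteq> t" by (simp add: eventually_at_filter)
  ultimately show ?thesis
  proof eventually_elim
    case (elim s)
    have "\<bar>form_norm (R (s - t))\<bar> \<le> e * \<bar>\<rho> (s - t)\<bar>"
      using elim(1) \<rho>[of "s - t"] elim(3) by (simp add: field_simps)
    then have "form_norm (R (s - t)) * (norm u * norm v) \<le> e * \<bar>\<rho> (s - t)\<bar> * (norm u * norm v)" for u v
      by (intro mult_right_mono) auto
    moreover have "\<bar>R (s - t) u v\<bar> \<le> form_norm (R (s - t)) * norm u * norm v" for u v
      using bil[of "s - t"] elim(2) by (intro abs_le_form_norm) auto
    ultimately show ?case by (metis mult.assoc order_trans)
  qed
qed

lemma twice_differentiable_family_form_has_derivative:
  assumes F: "twice_differentiable_family I F F' F''"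
    and I: "open I" "t \<in> I"
    and bil: "\<And>t. t \<in> I \<Longrightarrow> bounded_bilinear (F t)"
  shows "form_has_derivative F (F' t) t"
proof -
  note b = twice_differentiable_family_bounded_bilinear[OF F]
  have lim: "((\<lambda>h. form_norm (\<lambda>u v. F (t + h) u v - F t u v - h * F' t u v) / h) \<longlongrightarrow> 0) (at 0)"
    using F I(2) unfolding twice_differentiable_family_def by blast
  show ?thesis unfolding form_has_derivative_def
  proof (intro allI impI)
    fix e :: real assume "e > 0"
    from form_norm_tendsto_imp_uniform[OF lim _ I _ this]
    show "\<forall>\<^sub>F s in at t. \<forall>u v. \<bar>F s u v - F t u v - (s - t) * F' t u v\<bar> \<le> e * \<bar>s - t\<bar> * norm u * norm v"
      using I(2) by (simp add: bounded_bilinear_diff bounded_bilinear_cmult bil b)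
  qed
qed

lemma tendsto_imp_Bfun:
  fixes x :: "'a \<Rightarrow> 'b::metric_space"
  assumes "(x \<longlongrightarrow> l) F"
  shows "Bfun x F"
  unfolding Bfun_metric_def
  using tendstoD[OF assms, of 1] by (intro exI[of _ l] exI[of _ 1]) (auto elim: eventually_mono)

text \<open>
  The arguments may depend on the parameter and need only stay bounded: the difference quotient
  converges uniformly on bounded sets.
\<close>

lemma form_has_derivative_quotient:
  assumes F: "form_has_derivative F D t" and x: "Bfun x (at t)" and y: "Bfun y (at t)"
  shows "((\<lambda>s. (F s (x s) (y s) - F t (x s) (y s)) / (s - t) - D (x s) (y s)) \<longlongrightarrow> 0) (at t)"
proof (rule tendstoI)
  fix e :: real assume "e > 0"
  obtain K where K: "K > 0" "\<forall>\<^sub>F s in at t. norm (x s) \<le> K" using x by (rule BfunE)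
  obtain L where L: "L > 0" "\<forall>\<^sub>F s in at t. norm (y s) \<le> L" using y by (rule BfunE)
  define d where "d = e / (2 * K * L)"
  have "d > 0" using \<open>e > 0\<close> K L by (simp add: d_def)
  with F have "\<forall>\<^sub>F s in at t. \<forall>u v. \<bar>F s u v - F t u v - (s - t) * D u v\<bar> \<le> d * \<bar>s - t\<bar> * norm u * norm v"
    unfolding form_has_derivative_def by blast
  moreover have "\<forall>\<^sub>F s in at t. s \<noteq> t" by (simp add: eventually_at_filter)
  ultimately show "\<forall>\<^sub>F s in at t. dist ((F s (x s) (y s) - F t (x s) (y s)) / (s - t) - D (x s) (y s)) 0 < e"
    using K(2) L(2)
  proof eventually_elim
    case (elim s)
    have "\<bar>F s (x s) (y s) - F t (x s) (y s) - (s - t) * D (x s) (y s)\<bar> \<le>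
        d * \<bar>s - t\<bar> * (norm (x s) * norm (y s))" using elim(1) by (simp add: mult.assoc)
    also have "\<dots> \<le> d * \<bar>s - t\<bar> * (K * L)"
      using elim \<open>d > 0\<close> K by (intro mult_left_mono mult_mono) auto
    also have "\<dots> = e / 2 * \<bar>s - t\<bar>" using K L by (simp add: d_def)
    finally have "\<bar>F s (x s) (y s) - F t (x s) (y s) - (s - t) * D (x s) (y s)\<bar> / \<bar>s - t\<bar> \<le> e / 2"
      using elim(2) by (simp add: field_simps)
    moreover have "(F s (x s) (y s) - F t (x s) (y s)) / (s - t) - D (x s) (y s) =
        (F s (x s) (y s) - F t (x s) (y s) - (s - t) * D (x s) (y s)) / (s - t)"
      using elim(2) by (simp add: field_simps)
    ultimately show ?case using \<open>e > 0\<close> by (simp only: dist_0_norm dist_norm diff_zero real_norm_def abs_divide)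
  qed
qed

lemma form_has_derivative_increment_tendsto_zero:
  assumes F: "form_has_derivative F D t" and D: "bounded_bilinear D"
    and x: "Bfun x (at t)" and y: "Bfun y (at t)"
  shows "((\<lambda>s. F s (x s) (y s) - F t (x s) (y s)) \<longlongrightarrow> 0) (at t)"
proof -
  interpret D: bounded_bilinear D by fact
  have s: "((\<lambda>s. s - t) \<longlongrightarrow> 0) (at t)" by (intro tendsto_eq_intros | simp)+
  then have "Zfun (\<lambda>s. (s - t) *\<^sub>R x s) (at t)"
    using bounded_bilinear.Zfun_prod_Bfun[OF bounded_bilinear_scaleR _ x] by (simp add: tendsto_Zfun_iff)
  then have "Zfun (\<lambda>s. D ((s - t) *\<^sub>R x s) (y s)) (at t)" using y by (rule D.Zfun_prod_Bfun)
  then have "((\<lambda>s. (s - t) * D (x s) (y s)) \<longlongrightarrow> 0) (at t)"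
    by (simp add: tendsto_Zfun_iff D.scaleR_left)
  moreover have "((\<lambda>s. (s - t) * ((F s (x s) (y s) - F t (x s) (y s)) / (s - t) - D (x s) (y s))) \<longlongrightarrow> 0) (at t)"
    using tendsto_mult[OF s form_has_derivative_quotient[OF F x y]] by simp
  ultimately have "((\<lambda>s. (s - t) * ((F s (x s) (y s) - F t (x s) (y s)) / (s - t) - D (x s) (y s))
      + (s - t) * D (x s) (y s)) \<longlongrightarrow> 0) (at t)" by (intro tendsto_add_zero)
  then show ?thesis
    by (rule Lim_transform_eventually)
      (auto simp: eventually_at_filter field_simps)
qed

lemma has_vector_derivative_iff_quotient:
  fixes x :: "real \<Rightarrow> 'a::real_normed_vector"
  shows "(x has_vector_derivative x') (at t) \<longleftrightarrow> ((\<lambda>s. (x s - x t) /\<^sub>R (s - t)) \<longlongrightarrow> x') (at t)"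
proof -
  have "((\<lambda>s. (x s - x t) /\<^sub>R (s - t)) \<longlongrightarrow> x') (at t) \<longleftrightarrow>
      ((\<lambda>s. norm ((x s - x t) /\<^sub>R (s - t) - x')) \<longlongrightarrow> 0) (at t)"
    by (simp add: LIM_zero_iff tendsto_norm_zero_iff)
  also have "\<dots> \<longleftrightarrow> ((\<lambda>s. norm ((1 / norm (s - t)) *\<^sub>R (x s - (x t + (s - t) *\<^sub>R x')))) \<longlongrightarrow> 0) (at t)"
  proof (rule tendsto_cong)
    have "\<forall>\<^sub>F s in at t. s \<noteq> t" by (simp add: eventually_at_filter)
    then show "\<forall>\<^sub>F s in at t. norm ((x s - x t) /\<^sub>R (s - t) - x') =
        norm ((1 / norm (s - t)) *\<^sub>R (x s - (x t + (s - t) *\<^sub>R x')))"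
    proof eventually_elim
      case (elim s)
      have "(x s - x t) /\<^sub>R (s - t) - x' = (x s - (x t + (s - t) *\<^sub>R x')) /\<^sub>R (s - t)"
        using elim by (simp add: scaleR_diff_right scaleR_add_right)
      then show ?case by (simp add: divide_inverse)
    qed
  qed
  finally show ?thesis
    unfolding has_vector_derivative_def has_derivative_within
    by (simp only: bounded_linear_scaleR_left tendsto_norm_zero_iff simp_thms)
qed

lemma form_has_derivative_DERIV_apply:
  assumes F: "form_has_derivative F D t" and Ft: "bounded_bilinear (F t)" and D: "bounded_bilinear D"
    and x: "(x has_vector_derivative x') (at t)" and y: "(y has_vector_derivative y') (at t)"
  shows "((\<lambda>s. F s (x s) (y s)) has_real_derivative D (x t) (y t) + F t (x t) y' + F t x' (y t)) (at t)"
proof -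
  have xl: "(x \<longlongrightarrow> x t) (at t)" and yl: "(y \<longlongrightarrow> y t) (at t)"
    using has_vector_derivative_continuous[OF x] has_vector_derivative_continuous[OF y]
    by (simp_all add: continuous_at)
  have "((\<lambda>s. F t (x s) (y s)) has_vector_derivative F t (x t) y' + F t x' (y t)) (at t)"
    by (rule bounded_bilinear.has_vector_derivative[OF Ft x y])
  then have "((\<lambda>s. (F t (x s) (y s) - F t (x t) (y t)) / (s - t)) \<longlongrightarrow> F t (x t) y' + F t x' (y t)) (at t)"
    by (simp add: has_real_derivative_iff_has_vector_derivative[symmetric] has_field_derivative_iff)
  moreover have "((\<lambda>s. (F s (x s) (y s) - F t (x s) (y s)) / (s - t) - D (x s) (y s)) \<longlongrightarrow> 0) (at t)"
    by (rule form_has_derivative_quotient[OF F tendsto_imp_Bfun[OF xl] tendsto_imp_Bfun[OF yl]])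
  moreover have "((\<lambda>s. D (x s) (y s)) \<longlongrightarrow> D (x t) (y t)) (at t)"
    by (rule bounded_bilinear.tendsto[OF D xl yl])
  ultimately have "((\<lambda>s. (F s (x s) (y s) - F t (x s) (y s)) / (s - t) - D (x s) (y s) + D (x s) (y s) +
       (F t (x s) (y s) - F t (x t) (y t)) / (s - t)) \<longlongrightarrow> 0 + D (x t) (y t) + (F t (x t) y' + F t x' (y t))) (at t)"
    by (intro tendsto_add)
  then show ?thesis
    by (simp add: has_field_derivative_iff diff_divide_distrib add.assoc)
qed

lemma form_has_derivative_imp_DERIV:
  assumes "form_has_derivative F D t" "bounded_bilinear (F t)" "bounded_bilinear D"
  shows "((\<lambda>s. F s u v) has_real_derivative D u v) (at t)"
  using form_has_derivative_DERIV_apply[OF assms has_vector_derivative_const has_vector_derivative_const, of u v]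
  by (simp add: assms bounded_bilinear.zero_left bounded_bilinear.zero_right)

lemma form_has_derivative_diff:
  assumes "form_has_derivative F D t" "form_has_derivative G E t"
  shows "form_has_derivative (\<lambda>s u v. F s u v - G s u v) (\<lambda>u v. D u v - E u v) t"
  unfolding form_has_derivative_def
proof (intro allI impI)
  fix e :: real assume "e > 0"
  then have "e / 2 > 0" by simp
  with assms have "\<forall>\<^sub>F s in at t. \<forall>u v. \<bar>F s u v - F t u v - (s - t) * D u v\<bar> \<le> e / 2 * \<bar>s - t\<bar> * norm u * norm v"
    "\<forall>\<^sub>F s in at t. \<forall>u v. \<bar>G s u v - G t u v - (s - t) * E u v\<bar> \<le> e / 2 * \<bar>s - t\<bar> * norm u * norm v"
    unfolding form_has_derivative_def by blast+
  then show "\<forall>\<^sub>F s in at t. \<forall>u v. \<bar>F s u v - G s u v - (F t u v - G t u v) - (s - t) * (D u v - E u v)\<bar>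
      \<le> e * \<bar>s - t\<bar> * norm u * norm v"
  proof (eventually_elim, intro allI)
    fix s u v
    assume *: "\<forall>u v. \<bar>F s u v - F t u v - (s - t) * D u v\<bar> \<le> e / 2 * \<bar>s - t\<bar> * norm u * norm v"
      "\<forall>u v. \<bar>G s u v - G t u v - (s - t) * E u v\<bar> \<le> e / 2 * \<bar>s - t\<bar> * norm u * norm v"
    have "F s u v - G s u v - (F t u v - G t u v) - (s - t) * (D u v - E u v) =
        (F s u v - F t u v - (s - t) * D u v) - (G s u v - G t u v - (s - t) * E u v)"
      by (simp add: algebra_simps)
    also have "\<bar>\<dots>\<bar> \<le> e / 2 * \<bar>s - t\<bar> * norm u * norm v + e / 2 * \<bar>s - t\<bar> * norm u * norm v"
      by (rule order_trans[OF abs_triangle_ineq4 add_mono]) (use * in blast)+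
    also have "\<dots> = e * \<bar>s - t\<bar> * norm u * norm v" by simp
    finally show "\<bar>F s u v - G s u v - (F t u v - G t u v) - (s - t) * (D u v - E u v)\<bar>
      \<le> e * \<bar>s - t\<bar> * norm u * norm v" .
  qed
qed

text \<open>
  The product rule, with the remainder split as
  \<open>c\<^sub>s (F\<^sub>s - F\<^sub>t - (s - t) D) + (c\<^sub>s - c\<^sub>t - (s - t) c') F\<^sub>t + (s - t) (c\<^sub>s - c\<^sub>t) D\<close>; each of the three
  terms gets a third of the admissible error.
\<close>

lemma form_has_derivative_mult:
  assumes F: "form_has_derivative F D t" and Ft: "bounded_bilinear (F t)" and D: "bounded_bilinear D"
    and c: "(c has_real_derivative c') (at t)"
  shows "form_has_derivative (\<lambda>s u v. c s * F s u v) (\<lambda>u v. c' * F t u v + c t * D u v) t"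
  unfolding form_has_derivative_def
proof (intro allI impI)
  fix e :: real assume "e > 0"
  obtain K where K: "K > 0" "\<And>u v. norm (F t u v) \<le> norm u * norm v * K"
    using bounded_bilinear.pos_bounded[OF Ft] by blast
  obtain L where L: "L > 0" "\<And>u v. norm (D u v) \<le> norm u * norm v * L"
    using bounded_bilinear.pos_bounded[OF D] by blast
  have cl: "(c \<longlongrightarrow> c t) (at t)" using DERIV_isCont[OF c] by (simp add: isCont_def)
  define M where "M = \<bar>c t\<bar> + 1"
  have M: "M > 0" by (simp add: M_def)
  have "\<forall>\<^sub>F s in at t. \<bar>c s\<bar> < M"
    using order_tendstoD(2)[OF tendsto_rabs[OF cl]] by (simp add: M_def)
  moreover have "e / (3 * M) > 0" using M \<open>e > 0\<close> by simp
  then have "\<forall>\<^sub>F s in at t. \<forall>u v. \<bar>F s u v - F t u v - (s - t) * D u v\<bar> \<le> e / (3 * M) * \<bar>s - t\<bar> * norm u * norm v"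
    using F unfolding form_has_derivative_def by blast
  moreover have "\<forall>\<^sub>F s in at t. dist ((c s - c t) / (s - t)) c' < e / (3 * K)"
    using c K \<open>e > 0\<close> by (intro tendstoD) (auto simp: has_field_derivative_iff)
  moreover have "\<forall>\<^sub>F s in at t. dist (c s) (c t) < e / (3 * L)"
    using cl L \<open>e > 0\<close> by (intro tendstoD) auto
  moreover have "\<forall>\<^sub>F s in at t. s \<noteq> t" by (simp add: eventually_at_filter)
  ultimately show "\<forall>\<^sub>F s in at t. \<forall>u v. \<bar>c s * F s u v - c t * F t u v - (s - t) * (c' * F t u v + c t * D u v)\<bar>
      \<le> e * \<bar>s - t\<bar> * norm u * norm v"
  proof (eventually_elim, intro allI)
    fix s and u v :: 'a
    assume c1: "\<bar>c s\<bar> < M" and c2: "dist ((c s - c t) / (s - t)) c' < e / (3 * K)"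
      and c3: "dist (c s) (c t) < e / (3 * L)" and "s \<noteq> t"
      and f: "\<forall>u v. \<bar>F s u v - F t u v - (s - t) * D u v\<bar> \<le> e / (3 * M) * \<bar>s - t\<bar> * norm u * norm v"
    define N where "N = norm u * norm v"
    have N: "N \<ge> 0" by (simp add: N_def)
    have "\<bar>c s * (F s u v - F t u v - (s - t) * D u v)\<bar> \<le> M * (e / (3 * M) * \<bar>s - t\<bar> * N)"
      unfolding abs_mult using f c1 M by (intro mult_mono) (auto simp: N_def mult.assoc)
    then have 1: "\<bar>c s * (F s u v - F t u v - (s - t) * D u v)\<bar> \<le> e / 3 * \<bar>s - t\<bar> * N"
      using M by simp
    have "\<bar>c s - c t - (s - t) * c'\<bar> = \<bar>(c s - c t) / (s - t) - c'\<bar> * \<bar>s - t\<bar>"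
      using \<open>s \<noteq> t\<close> by (simp add: abs_mult[symmetric] field_simps)
    also have "\<dots> \<le> e / (3 * K) * \<bar>s - t\<bar>"
      using c2 by (intro mult_right_mono) (auto simp: dist_real_def)
    finally have "\<bar>(c s - c t - (s - t) * c') * F t u v\<bar> \<le> (e / (3 * K) * \<bar>s - t\<bar>) * (N * K)"
      unfolding abs_mult using K(2)[of u v] \<open>e > 0\<close> K(1) by (intro mult_mono) (auto simp: N_def)
    then have 2: "\<bar>(c s - c t - (s - t) * c') * F t u v\<bar> \<le> e / 3 * \<bar>s - t\<bar> * N"
      using K by (simp add: mult_ac)
    have "\<bar>(c s - c t) * D u v\<bar> \<le> e / (3 * L) * (N * L)"
      unfolding abs_mult using L(2)[of u v] L(1) c3 \<open>e > 0\<close>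
      by (intro mult_mono) (auto simp: N_def dist_real_def)
    then have "\<bar>(c s - c t) * D u v\<bar> \<le> e / 3 * N" using L by simp
    then have "\<bar>s - t\<bar> * \<bar>(c s - c t) * D u v\<bar> \<le> \<bar>s - t\<bar> * (e / 3 * N)" by (rule mult_left_mono) simp
    then have 3: "\<bar>(s - t) * ((c s - c t) * D u v)\<bar> \<le> e / 3 * \<bar>s - t\<bar> * N"
      by (simp only: abs_mult mult_ac)
    have "c s * F s u v - c t * F t u v - (s - t) * (c' * F t u v + c t * D u v) =
        c s * (F s u v - F t u v - (s - t) * D u v) + (c s - c t - (s - t) * c') * F t u v
        + (s - t) * ((c s - c t) * D u v)"
      by (simp add: algebra_simps)
    with 1 2 3 have "\<bar>c s * F s u v - c t * F t u v - (s - t) * (c' * F t u v + c t * D u v)\<bar>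
      \<le> e * \<bar>s - t\<bar> * N" by (simp only: abs_le_iff) linarith
    then show "\<bar>c s * F s u v - c t * F t u v - (s - t) * (c' * F t u v + c t * D u v)\<bar>
      \<le> e * \<bar>s - t\<bar> * norm u * norm v" by (simp add: N_def mult_ac)
  qed
qed

text \<open>
  For fixed arguments \<open>F'\<close> is the derivative of \<open>F\<close> and \<open>F''\<close> is the second order Taylor coefficient at
  each parameter. Near \<open>t\<close> the latter differs from \<open>F'' t\<close> by at most \<open>e \<parallel>u\<parallel> \<parallel>v\<parallel>\<close>, and
  \<open>peano_second_derivative_increment\<close> carries exactly this error over to the increments of \<open>F'\<close>.
\<close>

lemma twice_differentiable_family_form_has_second_derivative:
  assumes F: "twice_differentiable_family I F F' F''"
    and I: "open I" "t \<in> I"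
    and bil: "\<And>t. t \<in> I \<Longrightarrow> bounded_bilinear (F t)"
  shows "form_has_derivative F' (F'' t) t"
  unfolding form_has_derivative_def
proof (intro allI impI)
  fix e :: real assume e: "e > 0"
  note b = twice_differentiable_family_bounded_bilinear[OF F]
  have D: "((\<lambda>s. F s u v) has_real_derivative F' s u v) (at s)" if "s \<in> I" for s u v
    by (intro form_has_derivative_imp_DERIV twice_differentiable_family_form_has_derivative[OF F I(1) that bil]
        bil b that)
  have peano: "\<forall>\<^sub>F r in at s. \<bar>F r u v - F s u v - (r - s) * F' s u v - (r - s)\<^sup>2 / 2 * F'' s u v\<bar> \<le> d * (r - s)\<^sup>2"
    if "s \<in> I" "d > 0" for s u v d
  proof -
    define K where "K = norm u * norm v + 1"
    have K: "K > 0" "norm u * norm v \<le> K"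
      by (auto simp: K_def add_pos_pos add_nonneg_pos)
    have lim: "((\<lambda>h. form_norm (\<lambda>u v. F (s + h) u v - F s u v - h * F' s u v - h\<^sup>2 / 2 * F'' s u v) / h\<^sup>2) \<longlongrightarrow> 0) (at 0)"
      using F that unfolding twice_differentiable_family_def by blast
    have "d / K > 0" using that K by simp
    from form_norm_tendsto_imp_uniform[OF lim _ I(1) that(1) _ this]
    have "\<forall>\<^sub>F r in at s. \<forall>u v. \<bar>F r u v - F s u v - (r - s) * F' s u v - (r - s)\<^sup>2 / 2 * F'' s u v\<bar> \<le>
        d / K * (r - s)\<^sup>2 * norm u * norm v"
      using that by (simp add: bounded_bilinear_diff bounded_bilinear_cmult bil b del: times_divide_eq_left)
    then show ?thesis
    proof eventually_elim
      case (elim r)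
      have "\<bar>F r u v - F s u v - (r - s) * F' s u v - (r - s)\<^sup>2 / 2 * F'' s u v\<bar> \<le>
        (d / K * (r - s)\<^sup>2) * (norm u * norm v)" using elim by (simp add: mult_ac)
      also have "\<dots> \<le> (d / K * (r - s)\<^sup>2) * K"
        using that K by (intro mult_left_mono) auto
      finally show ?case using K by simp
    qed
  qed
  have "((\<lambda>h. form_norm (\<lambda>u v. F'' (t + h) u v - F'' t u v) / 1) \<longlongrightarrow> 0) (at 0)"
    using F I unfolding twice_differentiable_family_def by simp
  from form_norm_tendsto_imp_uniform[OF this _ I _ e]
  have "\<forall>\<^sub>F s in at t. \<forall>u v. \<bar>F'' s u v - F'' t u v\<bar> \<le> e * norm u * norm v"
    using I by (simp add: bounded_bilinear_diff b)
  then have "\<forall>\<^sub>F s in nhds t. \<forall>u v. \<bar>F'' s u v - F'' t u v\<bar> \<le> e * norm u * norm v"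
    using e by (simp add: eventually_at_filter) (auto elim!: eventually_mono)
  moreover have "\<forall>\<^sub>F s in nhds t. s \<in> I" using I by (rule eventually_nhds_in_open)
  ultimately have "\<forall>\<^sub>F s in nhds t. s \<in> I \<and> (\<forall>u v. \<bar>F'' s u v - F'' t u v\<bar> \<le> e * norm u * norm v)"
    by eventually_elim auto
  then obtain d where d: "d > 0" "\<And>s. dist s t < d \<Longrightarrow>
      s \<in> I \<and> (\<forall>u v. \<bar>F'' s u v - F'' t u v\<bar> \<le> e * norm u * norm v)"
    unfolding eventually_nhds_metric by blast
  have "\<bar>F' s u v - F' t u v - (s - t) * F'' t u v\<bar> \<le> e * \<bar>s - t\<bar> * norm u * norm v"
    if s: "dist s t < d" for s u v
  proof -
    consider "t < s" | "s < t" | "s = t" by linarith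
    then show ?thesis
    proof cases
      case 1
      have *: "r \<in> I \<and> (\<forall>u v. \<bar>F'' r u v - F'' t u v\<bar> \<le> e * norm u * norm v)" if "r \<in> {t..s}" for r
        using that s by (intro d(2)) (auto simp: dist_real_def)
      have "\<bar>F' s u v - F' t u v - (s - t) * F'' t u v\<bar> \<le> e * norm u * norm v * (s - t)"
        using * by (intro peano_second_derivative_increment[OF 1 D peano]) auto
      then show ?thesis using 1 by (simp add: mult_ac)
    next
      case 2
      have *: "r \<in> I \<and> (\<forall>u v. \<bar>F'' r u v - F'' t u v\<bar> \<le> e * norm u * norm v)" if "r \<in> {s..t}" for r
        using that s by (intro d(2)) (auto simp: dist_real_def)
      have "\<bar>F' t u v - F' s u v - (t - s) * F'' t u v\<bar> \<le> e * norm u * norm v * (t - s)"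
        using * by (intro peano_second_derivative_increment[OF 2 D peano]) auto
      moreover have "\<bar>F' s u v - F' t u v - (s - t) * F'' t u v\<bar> =
          \<bar>F' t u v - F' s u v - (t - s) * F'' t u v\<bar>"
        by (subst abs_minus_cancel[symmetric]) (simp add: algebra_simps)
      ultimately show ?thesis using 2 by (simp add: mult_ac)
    qed simp
  qed
  then show "\<forall>\<^sub>F s in at t. \<forall>u v. \<bar>F' s u v - F' t u v - (s - t) * F'' t u v\<bar> \<le> e * \<bar>s - t\<bar> * norm u * norm v"
    using d(1) by (auto simp: eventually_at)
qed

lemma form_has_derivative_pullback:
  assumes "form_has_derivative F D t" and "bounded_linear \<iota>"
  shows "form_has_derivative (\<lambda>s u v. F s (\<iota> u) (\<iota> v)) (\<lambda>u v. D (\<iota> u) (\<iota> v)) t"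
  unfolding form_has_derivative_def
proof (intro allI impI)
  fix e :: real assume e: "e > 0"
  obtain K where K: "K > 0" "\<And>u. norm (\<iota> u) \<le> norm u * K"
    using bounded_linear.pos_bounded[OF assms(2)] by blast
  have "e / (K * K) > 0" using K e by simp
  with assms(1) have "\<forall>\<^sub>F s in at t. \<forall>u v. \<bar>F s u v - F t u v - (s - t) * D u v\<bar> \<le>
      e / (K * K) * \<bar>s - t\<bar> * norm u * norm v" unfolding form_has_derivative_def by blast
  then show "\<forall>\<^sub>F s in at t. \<forall>u v. \<bar>F s (\<iota> u) (\<iota> v) - F t (\<iota> u) (\<iota> v) - (s - t) * D (\<iota> u) (\<iota> v)\<bar> \<le>
      e * \<bar>s - t\<bar> * norm u * norm v"
  proof (eventually_elim, intro allI)
    fix s u v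
    assume *: "\<forall>u v. \<bar>F s u v - F t u v - (s - t) * D u v\<bar> \<le> e / (K * K) * \<bar>s - t\<bar> * norm u * norm v"
    have "\<bar>F s (\<iota> u) (\<iota> v) - F t (\<iota> u) (\<iota> v) - (s - t) * D (\<iota> u) (\<iota> v)\<bar> \<le>
        e / (K * K) * \<bar>s - t\<bar> * (norm (\<iota> u) * norm (\<iota> v))"
      using spec[OF spec[OF *, of "\<iota> u"], of "\<iota> v"] by (simp only: mult.assoc)
    also have "\<dots> \<le> e / (K * K) * \<bar>s - t\<bar> * ((norm u * K) * (norm v * K))"
      using K e by (intro mult_left_mono mult_mono) auto
    also have "\<dots> = e * \<bar>s - t\<bar> * norm u * norm v" using K by simp
    finally show "\<bar>F s (\<iota> u) (\<iota> v) - F t (\<iota> u) (\<iota> v) - (s - t) * D (\<iota> u) (\<iota> v)\<bar> \<le>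
        e * \<bar>s - t\<bar> * norm u * norm v" .
  qed
qed

section \<open>The spectral gap above the lowest eigenvalue\<close>

lemma in_span_range_obtain_sum:
  fixes u :: "nat \<Rightarrow> 'a::real_vector"
  assumes "w \<in> span (range u)"
  obtains N d where "w = (\<Sum>n<N. d n *\<^sub>R u n)"
proof -
  from assms have "\<exists>N d. w = (\<Sum>n<N. d n *\<^sub>R u n)"
  proof (induction rule: span_induct_alt)
    case base
    show ?case by (intro exI[of _ 0]) simp
  next
    case (step c x y)
    then obtain k N d where x: "x = u k" and y: "y = (\<Sum>n<N. d n *\<^sub>R u n)" by blast
    define M where "M = max N (Suc k)"
    define d' where "d' n = (if n = k then c else 0) + (if n < N then d n else 0)" for n
    have "(\<Sum>n<M. d' n *\<^sub>R u n) =
        (\<Sum>n<M. if n = k then c *\<^sub>R u n else 0) + (\<Sum>n<M. if n < N then d n *\<^sub>R u n else 0)"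
      unfolding sum.distrib[symmetric] by (intro sum.cong) (auto simp: d'_def scaleR_add_left)
    also have "(\<Sum>n<M. if n = k then c *\<^sub>R u n else 0) = c *\<^sub>R u k"
      by (subst sum.delta) (auto simp: M_def)
    also have "(\<Sum>n<M. if n < N then d n *\<^sub>R u n else 0) = (\<Sum>n<N. d n *\<^sub>R u n)"
      by (rule sum.mono_neutral_cong_right) (auto simp: M_def)
    finally show ?case using x y by metis
  qed
  then show thesis using that by blast
qed

text \<open>
  Split \<open>v = P + z\<close> into a finite eigenfunction expansion and a rest orthogonal to it for both forms.
  On \<open>P\<close> the inequality is read off from the coefficients, of which the first vanishes; on \<open>z\<close> the form
  \<open>a\<close> is nonnegative, and \<open>b z z\<close> is at most \<open>b (v - w) (v - w)\<close> for every combination \<open>w\<close> of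
  the eigenfunctions used in \<open>P\<close>, as \<open>P\<close> is the best such approximation to \<open>v\<close>. Density makes this arbitrarily small.
\<close>

lemma second_eigenvalue_le_rayleigh:
  fixes a b :: "'v::real_normed_vector \<Rightarrow> 'v \<Rightarrow> real" and u :: "nat \<Rightarrow> 'v" and lam :: "nat \<Rightarrow> real"
  assumes a: "bounded_bilinear a" "\<And>v w. a v w = a w v" "\<And>v. 0 \<le> a v v"
    and b: "bounded_bilinear b" "\<And>v w. b v w = b w v" "\<And>v. 0 \<le> b v v"
    and eig: "\<And>n v. a (u n) v = lam n * b (u n) v"
    and orth: "\<And>m n. b (u m) (u n) = (if m = n then 1 else 0)"
    and lam: "mono lam" "0 \<le> lam 1"
    and dense: "\<And>v e. e > 0 \<Longrightarrow> \<exists>w\<in>span (range u). b (v - w) (v - w) < e"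
    and v: "b (u 0) v = 0"
  shows "lam 1 * b v v \<le> a v v"
proof -
  interpret a: bounded_bilinear a by fact
  interpret b: bounded_bilinear b by fact
  have *: "lam 1 * b v v \<le> a v v + lam 1 * e" if "e > 0" for e
  proof -
    obtain w where w: "w \<in> span (range u)" "b (v - w) (v - w) < e" using dense \<open>e > 0\<close> by blast
    obtain N d where wN: "w = (\<Sum>n<N. d n *\<^sub>R u n)" using in_span_range_obtain_sum[OF w(1)] .
    define P where "P = (\<Sum>n<N. b (u n) v *\<^sub>R u n)"
    define z where "z = v - P"
    have uP: "b (u n) P = b (u n) v" if "n < N" for n
      using that by (simp add: P_def b.sum_right b.scaleR_right orth if_distrib sum.delta cong: if_cong)
    have uz: "b (u n) z = 0" if "n < N" for n
      using uP[OF that] by (simp add: z_def b.diff_right)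
    have bz: "b (\<Sum>n<N. c n *\<^sub>R u n) z = 0" for c
      by (simp add: b.sum_left b.scaleR_left uz)
    have bPz: "b P z = 0" unfolding P_def by (rule bz)
    have aPz: "a P z = 0" by (simp add: P_def a.sum_left a.scaleR_left eig uz)
    have v_eq: "v = P + z" by (simp add: z_def)
    have "b v v = b P P + b z z"
      unfolding v_eq using bPz b(2)[of z P] by (simp add: b.add_left b.add_right)
    moreover have "b P P = (\<Sum>n<N. (b (u n) v)\<^sup>2)"
    proof -
      have "b P P = (\<Sum>n<N. b (u n) v * b (u n) P)"
        by (subst P_def, simp only: b.sum_left b.scaleR_left real_scaleR_def)
      then show ?thesis using uP by (simp add: power2_eq_square)
    qed
    moreover have "a v v = a P P + a z z"
      unfolding v_eq using aPz a(2)[of z P] by (simp add: a.add_left a.add_right)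
    moreover have "a P P = (\<Sum>n<N. lam n * (b (u n) v)\<^sup>2)"
    proof -
      have "a P P = (\<Sum>n<N. b (u n) v * a (u n) P)"
        by (subst P_def, simp only: a.sum_left a.scaleR_left real_scaleR_def)
      then show ?thesis using uP by (simp add: eig power2_eq_square mult_ac)
    qed
    moreover have "lam 1 * (\<Sum>n<N. (b (u n) v)\<^sup>2) \<le> (\<Sum>n<N. lam n * (b (u n) v)\<^sup>2)"
      unfolding sum_distrib_left
    proof (rule sum_mono)
      fix n
      show "lam 1 * (b (u n) v)\<^sup>2 \<le> lam n * (b (u n) v)\<^sup>2"
        using v monoD[OF lam(1), of 1 n] by (cases "n = 0") (auto intro: mult_right_mono)
    qed
    moreover have "b z z \<le> e"
    proof -
      define q where "q = P - w"
      have q: "q = (\<Sum>n<N. (b (u n) v - d n) *\<^sub>R u n)"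
        by (simp add: q_def P_def wN sum_subtractf scaleR_diff_left)
      have "b q z = 0" unfolding q by (rule bz)
      moreover have "v - w = z + q" by (simp add: z_def q_def)
      ultimately have "b (v - w) (v - w) = b z z + b q q"
        using b(2)[of z q] by (simp add: b.add_left b.add_right)
      then show ?thesis using w(2) b(3)[of q] by simp
    qed
    then have "lam 1 * b z z \<le> lam 1 * e" using lam(2) by (rule mult_left_mono)
    ultimately show ?thesis using a(3)[of z] by (simp add: distrib_left)
  qed
  show ?thesis
  proof (cases "lam 1 = 0")
    case False
    then have "lam 1 > 0" using lam(2) by simp
    show ?thesis
    proof (rule field_le_epsilon)
      fix e :: real assume "e > 0"
      then show "lam 1 * b v v \<le> a v v + e" using *[of "e / lam 1"] \<open>lam 1 > 0\<close> by simp
    qed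
  qed (use a(3) in simp)
qed

text \<open>
  The inequality \<open>lam 1 * b \<le> a\<close> on the complement of \<open>u 0\<close> implies
  \<open>a - lam 0 * b \<ge> (1 - lam 0 / lam 1) * a\<close> there, and \<open>a\<close> controls the norm.
\<close>

lemma eigensystem_spectral_gap:
  fixes \<iota> :: "'v::real_normed_vector \<Rightarrow> 'x::real_normed_vector"
  assumes es: "eigensystem \<iota> a b lam u" and gap: "lam 0 < lam 1"
    and \<iota>: "bounded_linear \<iota>"
    and a: "bounded_bilinear a" "\<And>v w. a v w = a w v" "\<And>v. \<delta> * (norm v)\<^sup>2 \<le> a v v"
    and b: "bounded_bilinear b" "\<And>v w. b v w = b w v" "\<And>v. 0 \<le> b v v"
    and \<delta>: "\<delta> > 0"
  shows "\<exists>c>0. \<forall>v. b (\<iota> (u 0)) (\<iota> v) = 0 \<longrightarrow> c * (norm v)\<^sup>2 \<le> a v v - lam 0 * b (\<iota> v) (\<iota> v)"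
proof -
  interpret \<iota>: bounded_linear \<iota> by fact
  have lam0: "lam 0 > 0" using es by (simp add: eigensystem_def)
  have pos: "0 \<le> a v v" for v
    using a(3)[of v] \<delta> by (meson order_trans mult_nonneg_nonneg less_imp_le zero_le_power2)
  have bi: "bounded_bilinear (\<lambda>v w. b (\<iota> v) (\<iota> w))"
    by (rule bounded_bilinear.comp[OF b(1) \<iota> \<iota>])
  obtain K where K: "K > 0" "\<And>x y. norm (b x y) \<le> norm x * norm y * K"
    using bounded_bilinear.pos_bounded[OF b(1)] by blast
  have dense: "\<exists>w\<in>span (range u). b (\<iota> (v - w)) (\<iota> (v - w)) < e" if "e > 0" for v e
  proof -
    have "\<iota> v \<in> closure (span (range (\<lambda>n. \<iota> (u n))))" using es by (simp add: eigensystem_def)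
    moreover have "sqrt (e / K) > 0" using that K by simp
    ultimately obtain y where y: "y \<in> span (range (\<lambda>n. \<iota> (u n)))" "dist y (\<iota> v) < sqrt (e / K)"
      unfolding closure_approachable by blast
    have "range (\<lambda>n. \<iota> (u n)) = \<iota> ` range u" by auto
    then obtain w where w: "w \<in> span (range u)" "y = \<iota> w"
      using y(1) by (auto simp: linear_span_image[OF bounded_linear.linear[OF \<iota>]])
    have n: "norm (\<iota> (v - w)) < sqrt (e / K)"
      using y(2) w by (simp add: dist_norm norm_minus_commute \<iota>.diff)
    have "b (\<iota> (v - w)) (\<iota> (v - w)) \<le> (norm (\<iota> (v - w)))\<^sup>2 * K"
      using K(2)[of "\<iota> (v - w)" "\<iota> (v - w)"] by (simp add: power2_eq_square)
    also have "\<dots> < (sqrt (e / K))\<^sup>2 * K"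
      using n K by (intro mult_strict_right_mono power_strict_mono) auto
    also have "\<dots> = e" using that K by simp
    finally show ?thesis using w by blast
  qed
  have ray: "lam 1 * b (\<iota> v) (\<iota> v) \<le> a v v" if "b (\<iota> (u 0)) (\<iota> v) = 0" for v
  proof (rule second_eigenvalue_le_rayleigh[OF a(1,2) pos bi b(2,3) _ _ _ _ dense])
    show "b (\<iota> (u 0)) (\<iota> v) = 0" by fact
    show "0 \<le> lam 1" using lam0 gap by simp
  qed (use es in \<open>auto simp: eigensystem_def normalized_eigenpair_def\<close>)
  define c where "c = (1 - lam 0 / lam 1) * \<delta>"
  have "c > 0" using lam0 gap \<delta> by (simp add: c_def)
  moreover have "c * (norm v)\<^sup>2 \<le> a v v - lam 0 * b (\<iota> v) (\<iota> v)" if v: "b (\<iota> (u 0)) (\<iota> v) = 0" for v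
  proof -
    have "c * (norm v)\<^sup>2 \<le> (1 - lam 0 / lam 1) * a v v"
      unfolding c_def mult.assoc using lam0 gap by (intro mult_left_mono a(3)) simp
    moreover have "lam 0 / lam 1 * (lam 1 * b (\<iota> v) (\<iota> v)) \<le> lam 0 / lam 1 * a v v"
      using ray[OF v] lam0 gap by (intro mult_left_mono) auto
    ultimately show ?thesis using lam0 gap by (simp add: left_diff_distrib)
  qed
  ultimately show ?thesis by blast
qed

section \<open>Perturbation of a simple lowest eigenvalue\<close>

text \<open>
  A branch of eigenpairs of two differentiable families of forms, isolated in the sense that the
  defect \<open>a\<^sub>t - \<lambda>(t) b\<^sub>t\<close> is coercive on the complement of the eigenfunction. As a function of \<open>t\<close>
  the eigenfunction may change its sign arbitrarily, so only quantities insensitive to the sign are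
  expected to be regular.
\<close>

locale simple_lowest_eigenvalue =
  fixes I :: "real set"
    and a a' a'' b b' b'' :: "real \<Rightarrow> 'v::{real_normed_vector,complete_space} \<Rightarrow> 'v \<Rightarrow> real"
    and lam :: "real \<Rightarrow> real" and \<phi> :: "real \<Rightarrow> 'v" and \<delta> :: real
  assumes open_I: "open I"
    and bilinear:
      "t \<in> I \<Longrightarrow> bounded_bilinear (a t)" "t \<in> I \<Longrightarrow> bounded_bilinear (a' t)" "t \<in> I \<Longrightarrow> bounded_bilinear (a'' t)"
      "t \<in> I \<Longrightarrow> bounded_bilinear (b t)" "t \<in> I \<Longrightarrow> bounded_bilinear (b' t)" "t \<in> I \<Longrightarrow> bounded_bilinear (b'' t)"
    and symmetric: "t \<in> I \<Longrightarrow> a t u v = a t v u" "t \<in> I \<Longrightarrow> b t u v = b t v u"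
    and coercive: "\<delta> > 0" "t \<in> I \<Longrightarrow> \<delta> * (norm v)\<^sup>2 \<le> a t v v"
    and derivative:
      "t \<in> I \<Longrightarrow> form_has_derivative a (a' t) t" "t \<in> I \<Longrightarrow> form_has_derivative a' (a'' t) t"
      "t \<in> I \<Longrightarrow> form_has_derivative b (b' t) t" "t \<in> I \<Longrightarrow> form_has_derivative b' (b'' t) t"
    and eigen: "t \<in> I \<Longrightarrow> a t (\<phi> t) v = lam t * b t (\<phi> t) v" "t \<in> I \<Longrightarrow> b t (\<phi> t) (\<phi> t) = 1"
    and gap: "t \<in> I \<Longrightarrow> \<exists>c>0. \<forall>v. b t (\<phi> t) v = 0 \<longrightarrow> c * (norm v)\<^sup>2 \<le> a t v v - lam t * b t v v"
begin

definition defect :: "real \<Rightarrow> 'v \<Rightarrow> 'v \<Rightarrow> real"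
  where "defect t u v = a t u v - lam t * b t u v"

lemma bounded_bilinear_defect: "t \<in> I \<Longrightarrow> bounded_bilinear (defect t)"
  unfolding defect_def by (intro bounded_bilinear_diff bounded_bilinear_cmult bilinear)

lemma defect_sym: "t \<in> I \<Longrightarrow> defect t u v = defect t v u"
  by (simp add: defect_def symmetric(1)[of t u v] symmetric(2)[of t u v])

lemma defect_eigenfunction: "t \<in> I \<Longrightarrow> defect t (\<phi> t) v = 0" "t \<in> I \<Longrightarrow> defect t v (\<phi> t) = 0"
  using defect_sym[of t v "\<phi> t"] by (auto simp: defect_def eigen)

definition overlap :: "real \<Rightarrow> real \<Rightarrow> real"
  where "overlap t s = b t (\<phi> t) (\<phi> s)"

definition transversal :: "real \<Rightarrow> real \<Rightarrow> 'v"
  where "transversal t s = \<phi> s - overlap t s *\<^sub>R \<phi> t"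

text \<open>
  Dividing by the overlap removes the arbitrary sign of \<open>\<phi> s\<close> and normalises its component along
  \<open>\<phi> t\<close>, so that \<open>aligned t s - \<phi> t\<close> is orthogonal to \<open>\<phi> t\<close>. Where the overlap is zero the value is \<open>0\<close>;
  near \<open>s = t\<close> this does not happen.
\<close>

definition aligned :: "real \<Rightarrow> real \<Rightarrow> 'v"
  where "aligned t s = \<phi> s /\<^sub>R overlap t s"

lemma defect_subtract_eigenfunction:
  assumes "t \<in> I"
  shows "defect t (v - k *\<^sub>R \<phi> t) (v - k *\<^sub>R \<phi> t) = defect t v v"
proof -
  interpret L: bounded_bilinear "defect t" using assms by (rule bounded_bilinear_defect)
  show ?thesis
    using assms by (simp add: L.diff_left L.diff_right L.scaleR_left L.scaleR_right defect_eigenfunction)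
qed

text \<open>
  Removing the component along \<open>\<phi> t\<close> leaves the value of the defect unchanged, and on the complement
  the gap makes it nonnegative.
\<close>

lemma rayleigh_lower_bound:
  assumes "t \<in> I"
  shows "lam t * b t v v \<le> a t v v"
proof -
  interpret b: bounded_bilinear "b t" using assms by (rule bilinear)
  define k where "k = b t (\<phi> t) v"
  have "b t (\<phi> t) (v - k *\<^sub>R \<phi> t) = 0"
    using assms by (simp add: b.diff_right b.scaleR_right eigen k_def)
  then obtain d where "d > 0" "d * (norm (v - k *\<^sub>R \<phi> t))\<^sup>2 \<le> defect t (v - k *\<^sub>R \<phi> t) (v - k *\<^sub>R \<phi> t)"
    using gap[OF assms] unfolding defect_def by blast
  then have "0 \<le> defect t v v"
    unfolding defect_subtract_eigenfunction[OF assms] by (meson order_trans mult_nonneg_nonneg less_imp_le zero_le_power2)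
  then show ?thesis by (simp add: defect_def)
qed

lemma form_tendsto:
  assumes "t \<in> I"
  shows "((\<lambda>s. a s u v) \<longlongrightarrow> a t u v) (at t)" "((\<lambda>s. b s u v) \<longlongrightarrow> b t u v) (at t)"
  using DERIV_isCont[OF form_has_derivative_imp_DERIV[OF derivative(1) bilinear(1,2)]]
    DERIV_isCont[OF form_has_derivative_imp_DERIV[OF derivative(3) bilinear(4,5)]] assms
  by (auto simp: isCont_def)

lemma eventually_in_I: "t \<in> I \<Longrightarrow> \<forall>\<^sub>F s in at t. s \<in> I"
  using open_I by (rule eventually_at_in_open')

text \<open>
  Using \<open>\<phi> t\<close> as a trial function at \<open>s\<close> bounds \<open>lam s\<close> by a Rayleigh quotient that is continuous in \<open>s\<close>.
  This one-sided bound yields the convergence of the eigenfunctions, from which the regularity of \<open>lam\<close>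
  follows.
\<close>

lemma eigenvalue_upper_semicontinuous:
  assumes t: "t \<in> I" and "e > 0"
  shows "\<forall>\<^sub>F s in at t. lam s < lam t + e"
proof -
  have "((\<lambda>s. a s (\<phi> t) (\<phi> t) / b s (\<phi> t) (\<phi> t)) \<longlongrightarrow> a t (\<phi> t) (\<phi> t) / b t (\<phi> t) (\<phi> t)) (at t)"
    using t by (intro tendsto_divide form_tendsto) (auto simp: eigen)
  then have "\<forall>\<^sub>F s in at t. a s (\<phi> t) (\<phi> t) / b s (\<phi> t) (\<phi> t) < lam t + e"
    by (rule order_tendstoD(2)) (use t \<open>e > 0\<close> in \<open>simp add: eigen\<close>)
  moreover have "\<forall>\<^sub>F s in at t. 0 < b s (\<phi> t) (\<phi> t)"
    by (rule order_tendstoD(1)[OF form_tendsto(2)]) (use t in \<open>simp_all add: eigen\<close>)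
  ultimately show ?thesis using eventually_in_I[OF t]
  proof eventually_elim
    case (elim s)
    have "lam s \<le> a s (\<phi> t) (\<phi> t) / b s (\<phi> t) (\<phi> t)"
      using rayleigh_lower_bound[OF elim(3)] elim(2) by (simp add: field_simps)
    then show ?case using elim(1) by simp
  qed
qed

text \<open>
  By coercivity, \<open>\<delta> \<parallel>\<phi> s\<parallel>\<^sup>2 \<le> a s (\<phi> s) (\<phi> s) = lam s\<close>.
\<close>

lemma eigenfunction_Bfun:
  assumes t: "t \<in> I"
  shows "Bfun \<phi> (at t)"
proof (rule BfunI)
  show "\<forall>\<^sub>F s in at t. norm (\<phi> s) \<le> sqrt ((lam t + 1) / \<delta>)"
    using eigenvalue_upper_semicontinuous[OF t zero_less_one] eventually_in_I[OF t]
  proof eventually_elim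
    case (elim s)
    have "\<delta> * (norm (\<phi> s))\<^sup>2 \<le> lam t + 1"
      using coercive(2)[OF elim(2), of "\<phi> s"] elim by (simp add: eigen)
    then show ?case using coercive(1) by (intro real_le_rsqrt) (simp add: field_simps)
  qed
qed

lemma transversal_orthogonal:
  assumes t: "t \<in> I"
  shows "b t (\<phi> t) (transversal t s) = 0"
proof -
  interpret b: bounded_bilinear "b t" using assms by (rule bilinear)
  show ?thesis using t by (simp add: transversal_def overlap_def b.diff_right b.scaleR_right eigen)
qed

text \<open>
  The gap bounds \<open>\<parallel>transversal t s\<parallel>\<^sup>2\<close> by a multiple of \<open>defect t\<close> on \<open>\<phi> s\<close>. By the equation of \<open>\<phi> s\<close> this
  value is \<open>lam s - lam t\<close>, which is at most small by semicontinuity, plus changes of \<open>a\<close> and \<open>b\<close> on the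
  bounded family \<open>\<phi> s\<close>.
\<close>

lemma transversal_tendsto_zero:
  assumes t: "t \<in> I"
  shows "((\<lambda>s. (norm (transversal t s))\<^sup>2) \<longlongrightarrow> 0) (at t)"
proof -
  obtain d where d: "d > 0" "\<And>v. b t (\<phi> t) v = 0 \<Longrightarrow> d * (norm v)\<^sup>2 \<le> defect t v v"
    using gap[OF t] unfolding defect_def by blast
  note B = eigenfunction_Bfun[OF t]
  \<comment> \<open>the value of \<open>defect t\<close> on \<open>\<phi> s\<close>, except for the change of the eigenvalue\<close>
  define r where "r s = - (a s (\<phi> s) (\<phi> s) - a t (\<phi> s) (\<phi> s))
      + lam t * (b s (\<phi> s) (\<phi> s) - b t (\<phi> s) (\<phi> s))" for s
  have "(r \<longlongrightarrow> - 0 + lam t * 0) (at t)" unfolding r_def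
    using t by (intro tendsto_intros form_has_derivative_increment_tendsto_zero[OF derivative(1) bilinear(2) B B]
        form_has_derivative_increment_tendsto_zero[OF derivative(3) bilinear(5) B B])
  then have r: "(r \<longlongrightarrow> 0) (at t)" by simp
  show ?thesis
  proof (rule tendstoI)
    fix e :: real assume "e > 0"
    then have e: "d * e / 2 > 0" using d by simp
    have "\<forall>\<^sub>F s in at t. r s < d * e / 2" using order_tendstoD(2)[OF r e] .
    then show "\<forall>\<^sub>F s in at t. dist ((norm (transversal t s))\<^sup>2) 0 < e"
      using eigenvalue_upper_semicontinuous[OF t e] eventually_in_I[OF t]
    proof eventually_elim
      case (elim s)
      have "d * (norm (transversal t s))\<^sup>2 \<le> defect t (transversal t s) (transversal t s)" by (intro d transversal_orthogonal t)
      also have "\<dots> = r s + (lam s - lam t)"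
        unfolding transversal_def defect_subtract_eigenfunction[OF t]
        using elim(3) by (simp add: r_def defect_def eigen algebra_simps)
      also have "\<dots> < d * e" using elim by simp
      finally show ?case using d by simp
    qed
  qed
qed

text \<open>
  Pythagoras for \<open>b t\<close>: the square of the overlap is \<open>b t (\<phi> s) (\<phi> s)\<close> minus the contribution of the
  transversal part, and \<open>b t (\<phi> s) (\<phi> s)\<close> is close to \<open>b s (\<phi> s) (\<phi> s) = 1\<close>. Only the square converges,
  because the sign of \<open>\<phi> s\<close> is arbitrary.
\<close>

lemma overlap_squared_tendsto:
  assumes t: "t \<in> I"
  shows "((\<lambda>s. (overlap t s)\<^sup>2) \<longlongrightarrow> 1) (at t)"
proof -
  interpret b: bounded_bilinear "b t" using t by (rule bilinear)
  note B = eigenfunction_Bfun[OF t]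
  have w: "(transversal t \<longlongrightarrow> 0) (at t)"
    using tendsto_real_sqrt[OF transversal_tendsto_zero[OF t]] by (simp add: tendsto_norm_zero_iff)
  have "((\<lambda>s. 1 - (b s (\<phi> s) (\<phi> s) - b t (\<phi> s) (\<phi> s)) - b t (transversal t s) (transversal t s)) \<longlongrightarrow> 1 - 0 - 0) (at t)"
    using t by (intro tendsto_diff tendsto_const b.tendsto_zero w
        form_has_derivative_increment_tendsto_zero[OF derivative(3) bilinear(5) B B])
  moreover have "\<forall>\<^sub>F s in at t. 1 - (b s (\<phi> s) (\<phi> s) - b t (\<phi> s) (\<phi> s)) - b t (transversal t s) (transversal t s) = (overlap t s)\<^sup>2"
    using eventually_in_I[OF t]
  proof eventually_elim
    case (elim s)
    have "\<phi> s = overlap t s *\<^sub>R \<phi> t + transversal t s" by (simp add: transversal_def)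
    then have "b t (\<phi> s) (\<phi> s) = b t (overlap t s *\<^sub>R \<phi> t + transversal t s) (overlap t s *\<^sub>R \<phi> t + transversal t s)" by simp
    also have "\<dots> = (overlap t s)\<^sup>2 + b t (transversal t s) (transversal t s)"
      using transversal_orthogonal[OF t, of s] symmetric(2)[OF t, of "\<phi> t" "transversal t s"]
      by (simp add: b.add_left b.add_right b.scaleR_left b.scaleR_right eigen t power2_eq_square)
    finally show ?case using elim by (simp add: eigen)
  qed
  ultimately show ?thesis by (simp add: tendsto_cong)
qed

lemma eventually_overlap_nonzero: "t \<in> I \<Longrightarrow> \<forall>\<^sub>F s in at t. overlap t s \<noteq> 0"
  using order_tendstoD(1)[OF overlap_squared_tendsto zero_less_one] by (auto elim: eventually_mono)

lemma aligned_self: "t \<in> I \<Longrightarrow> aligned t t = \<phi> t"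
  by (simp add: aligned_def overlap_def eigen)

lemma aligned_tendsto:
  assumes t: "t \<in> I"
  shows "(aligned t \<longlongrightarrow> \<phi> t) (at t)"
proof -
  have "((\<lambda>s. (norm (transversal t s))\<^sup>2 / (overlap t s)\<^sup>2) \<longlongrightarrow> 0 / 1) (at t)"
    by (intro tendsto_divide transversal_tendsto_zero overlap_squared_tendsto t) simp
  moreover have "\<forall>\<^sub>F s in at t. (norm (transversal t s))\<^sup>2 / (overlap t s)\<^sup>2 = (norm (aligned t s - \<phi> t))\<^sup>2"
    using eventually_overlap_nonzero[OF t]
  proof eventually_elim
    case (elim s)
    then have "aligned t s - \<phi> t = transversal t s /\<^sub>R overlap t s"
      by (simp add: aligned_def transversal_def scaleR_diff_right)
    then show ?case by (simp add: power_mult_distrib divide_inverse power_inverse)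
  qed
  ultimately have "((\<lambda>s. (norm (aligned t s - \<phi> t))\<^sup>2) \<longlongrightarrow> 0) (at t)" by (simp add: tendsto_cong)
  from tendsto_real_sqrt[OF this] show ?thesis
    by (simp add: tendsto_norm_zero_iff LIM_zero_iff)
qed

lemma defect_aligned:
  assumes "s \<in> I"
  shows "defect s (aligned t s) v = 0"
proof -
  interpret L: bounded_bilinear "defect s" using assms by (rule bounded_bilinear_defect)
  show ?thesis using assms by (simp add: aligned_def L.scaleR_left defect_eigenfunction)
qed

lemma overlap_aligned:
  assumes "t \<in> I" "overlap t s \<noteq> 0"
  shows "b t (\<phi> t) (aligned t s) = 1"
proof -
  interpret b: bounded_bilinear "b t" using assms by (intro bilinear)
  show ?thesis using assms by (simp add: aligned_def b.scaleR_right overlap_def[symmetric])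
qed

definition lam' :: "real \<Rightarrow> real"
  where "lam' t = a' t (\<phi> t) (\<phi> t) - lam t * b' t (\<phi> t) (\<phi> t)"

text \<open>
  Subtracting the equation of \<open>\<phi> t\<close> tested with \<open>aligned t s\<close> from that of \<open>aligned t s\<close> tested with
  \<open>\<phi> t\<close> gives
  \<open>(lam s - lam t) b\<^sub>s(\<psi>, \<phi>) = (a\<^sub>s - a\<^sub>t)(\<psi>, \<phi>) - lam t (b\<^sub>s - b\<^sub>t)(\<psi>, \<phi>)\<close>
  with \<open>\<psi> = aligned t s\<close>, by symmetry of the forms. Convergence of \<open>\<psi>\<close> to \<open>\<phi> t\<close>
  suffices to pass to the limit after division by \<open>s - t\<close>.
\<close>

lemma DERIV_eigenvalue:
  assumes t: "t \<in> I"
  shows "(lam has_real_derivative lam' t) (at t)"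
proof -
  define qa where "qa s = (a s (aligned t s) (\<phi> t) - a t (aligned t s) (\<phi> t)) / (s - t)" for s
  define qb where "qb s = (b s (aligned t s) (\<phi> t) - b t (aligned t s) (\<phi> t)) / (s - t)" for s
  note lim = aligned_tendsto[OF t]
  note B = tendsto_imp_Bfun[OF lim]
  have "((\<lambda>s. qa s - a' t (aligned t s) (\<phi> t) + a' t (aligned t s) (\<phi> t)) \<longlongrightarrow> 0 + a' t (\<phi> t) (\<phi> t)) (at t)"
    unfolding qa_def
    by (intro tendsto_add form_has_derivative_quotient[OF derivative(1)[OF t] B Bfun_const]
        bounded_bilinear.tendsto[OF bilinear(2)[OF t]] lim tendsto_const)
  then have qa: "(qa \<longlongrightarrow> a' t (\<phi> t) (\<phi> t)) (at t)" by simp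
  have "((\<lambda>s. qb s - b' t (aligned t s) (\<phi> t) + b' t (aligned t s) (\<phi> t)) \<longlongrightarrow> 0 + b' t (\<phi> t) (\<phi> t)) (at t)"
    unfolding qb_def
    by (intro tendsto_add form_has_derivative_quotient[OF derivative(3)[OF t] B Bfun_const]
        bounded_bilinear.tendsto[OF bilinear(5)[OF t]] lim tendsto_const)
  then have qb: "(qb \<longlongrightarrow> b' t (\<phi> t) (\<phi> t)) (at t)" by simp
  have "((\<lambda>s. (b s (aligned t s) (\<phi> t) - b t (aligned t s) (\<phi> t)) + b t (aligned t s) (\<phi> t)) \<longlongrightarrow> 0 + b t (\<phi> t) (\<phi> t)) (at t)"
    by (intro tendsto_add bounded_bilinear.tendsto[OF bilinear(4)[OF t]] lim tendsto_const
        form_has_derivative_increment_tendsto_zero[OF derivative(3)[OF t] bilinear(5)[OF t] B Bfun_const])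
  then have b1: "((\<lambda>s. b s (aligned t s) (\<phi> t)) \<longlongrightarrow> 1) (at t)" using t by (simp add: eigen)
  have "((\<lambda>s. (qa s - lam t * qb s) / b s (aligned t s) (\<phi> t)) \<longlongrightarrow> lam' t / 1) (at t)"
    unfolding lam'_def by (intro tendsto_intros qa qb b1) simp
  moreover have "\<forall>\<^sub>F s in at t. (qa s - lam t * qb s) / b s (aligned t s) (\<phi> t) = (lam s - lam t) / (s - t)"
    using eventually_in_I[OF t] order_tendstoD(1)[OF b1 zero_less_one]
  proof eventually_elim
    case (elim s)
    have "a s (aligned t s) (\<phi> t) = lam s * b s (aligned t s) (\<phi> t)"
      using defect_aligned[OF elim(1), of t "\<phi> t"] by (simp add: defect_def)
    moreover have "a t (aligned t s) (\<phi> t) = lam t * b t (aligned t s) (\<phi> t)"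
      using defect_eigenfunction(2)[OF t, of "aligned t s"] by (simp add: defect_def)
    ultimately have "qa s - lam t * qb s = (lam s - lam t) / (s - t) * b s (aligned t s) (\<phi> t)"
      unfolding qa_def qb_def by (simp add: diff_divide_distrib algebra_simps)
    then show ?case using elim(2) by simp
  qed
  ultimately show ?thesis by (simp add: has_field_derivative_iff tendsto_cong)
qed

definition defect' :: "real \<Rightarrow> 'v \<Rightarrow> 'v \<Rightarrow> real"
  where "defect' t u v = a' t u v - (lam' t * b t u v + lam t * b' t u v)"

lemma defect_has_derivative:
  assumes t: "t \<in> I"
  shows "form_has_derivative defect (defect' t) t"
  using form_has_derivative_diff[OF derivative(1)[OF t]
      form_has_derivative_mult[OF derivative(3)[OF t] bilinear(4)[OF t] bilinear(5)[OF t] DERIV_eigenvalue[OF t]]]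
  by (simp add: defect_def[abs_def] defect'_def[abs_def])

lemma bounded_bilinear_defect':
  assumes t: "t \<in> I"
  shows "bounded_bilinear (defect' t)"
proof -
  have "bounded_bilinear (\<lambda>u v. a' t u v - lam' t * b t u v - lam t * b' t u v)"
    using t by (intro bounded_bilinear_diff bounded_bilinear_cmult bilinear)
  then show ?thesis by (simp add: defect'_def[abs_def] diff_diff_eq)
qed

text \<open>
  The quotients \<open>Q s\<close> satisfy \<open>defect t (Q s) v \<approx> - defect' t (\<phi> t) v\<close> with an error \<open>e \<parallel>v\<parallel>\<close>, because
  \<open>defect s (aligned t s)\<close> and \<open>defect t (\<phi> t)\<close> vanish. Two of them thus differ by some \<open>v\<close>, orthogonal to \<open>\<phi> t\<close>,
  for which \<open>defect t v v\<close> is at most \<open>2 e \<parallel>v\<parallel>\<close>; the gap turns this into a bound of order \<open>e\<close> on \<open>\<parallel>v\<parallel>\<close>.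
  So completeness of the space yields the derivative as a limit of the quotients.
\<close>

lemma aligned_differentiable:
  assumes t: "t \<in> I"
  obtains z where "(aligned t has_vector_derivative z) (at t)"
proof -
  define Q where "Q s = (aligned t s - aligned t t) /\<^sub>R (s - t)" for s
  interpret L: bounded_bilinear "defect t" using t by (rule bounded_bilinear_defect)
  interpret L': bounded_bilinear "defect' t" using t by (rule bounded_bilinear_defect')
  interpret b: bounded_bilinear "b t" using t by (rule bilinear)
  obtain d where d: "d > 0" "\<And>v. b t (\<phi> t) v = 0 \<Longrightarrow> d * (norm v)\<^sup>2 \<le> defect t v v"
    using gap[OF t] unfolding defect_def by blast
  obtain K where K: "K > 0" "\<And>u v. norm (defect' t u v) \<le> norm u * norm v * K"
    using L'.pos_bounded by blast
  have approx: "\<forall>\<^sub>F s in at t. \<forall>v. \<bar>defect t (Q s) v + defect' t (\<phi> t) v\<bar> \<le> e * norm v" if "e > 0" for e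
  proof -
    define M where "M = norm (\<phi> t) + 1"
    have M: "M > 0" by (simp add: M_def add_nonneg_pos)
    have "e / (2 * M) > 0" using M \<open>e > 0\<close> by simp
    then have "\<forall>\<^sub>F s in at t. \<forall>u v. \<bar>defect s u v - defect t u v - (s - t) * defect' t u v\<bar>
        \<le> e / (2 * M) * \<bar>s - t\<bar> * norm u * norm v"
      using defect_has_derivative[OF t] unfolding form_has_derivative_def by blast
    moreover have "\<forall>\<^sub>F s in at t. norm (aligned t s) < M"
      by (rule order_tendstoD(2)[OF tendsto_norm[OF aligned_tendsto[OF t]]]) (simp add: M_def)
    moreover have "\<forall>\<^sub>F s in at t. dist (aligned t s) (\<phi> t) < e / (2 * K)"
      using K \<open>e > 0\<close> by (intro tendstoD[OF aligned_tendsto[OF t]]) auto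
    moreover have "\<forall>\<^sub>F s in at t. s \<noteq> t" by (simp add: eventually_at_filter)
    ultimately show ?thesis using eventually_in_I[OF t]
    proof (eventually_elim, intro allI)
      fix s v
      assume *: "\<forall>u v. \<bar>defect s u v - defect t u v - (s - t) * defect' t u v\<bar> \<le> e / (2 * M) * \<bar>s - t\<bar> * norm u * norm v"
        and M': "norm (aligned t s) < M" and K': "dist (aligned t s) (\<phi> t) < e / (2 * K)" and "s \<noteq> t" "s \<in> I"
      have LQ: "defect t (aligned t s) v = (s - t) * defect t (Q s) v"
      proof -
        have "aligned t s = \<phi> t + (s - t) *\<^sub>R Q s" using \<open>s \<noteq> t\<close> by (simp add: Q_def aligned_self t)
        then show ?thesis using t by (simp add: L.add_left L.scaleR_left defect_eigenfunction)
      qed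
      have "\<bar>(s - t) * (defect t (Q s) v + defect' t (aligned t s) v)\<bar> = \<bar>defect s (aligned t s) v - defect t (aligned t s) v - (s - t) * defect' t (aligned t s) v\<bar>"
        unfolding LQ defect_aligned[OF \<open>s \<in> I\<close>] by (subst abs_minus_cancel[symmetric]) (simp add: algebra_simps)
      also have "\<dots> \<le> e / (2 * M) * \<bar>s - t\<bar> * norm (aligned t s) * norm v" using * by blast
      also have "\<dots> \<le> e / (2 * M) * \<bar>s - t\<bar> * M * norm v"
        using M' M \<open>e > 0\<close> by (intro mult_left_mono mult_right_mono) auto
      also have "\<dots> = \<bar>s - t\<bar> * (e / 2 * norm v)" using M by simp
      finally have 1: "\<bar>defect t (Q s) v + defect' t (aligned t s) v\<bar> \<le> e / 2 * norm v"
        using \<open>s \<noteq> t\<close> by (simp add: abs_mult)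
      have "\<bar>defect' t (aligned t s - \<phi> t) v\<bar> \<le> norm (aligned t s - \<phi> t) * norm v * K" using K(2) by simp
      also have "\<dots> \<le> e / (2 * K) * norm v * K"
        using K' K(1) by (intro mult_right_mono) (auto simp: dist_norm)
      also have "\<dots> = e / 2 * norm v" using K by simp
      finally have 2: "\<bar>defect' t (aligned t s - \<phi> t) v\<bar> \<le> e / 2 * norm v" .
      have "defect t (Q s) v + defect' t (\<phi> t) v = (defect t (Q s) v + defect' t (aligned t s) v) - defect' t (aligned t s - \<phi> t) v"
        by (simp add: L'.diff_left)
      also have "\<bar>\<dots>\<bar> \<le> e / 2 * norm v + e / 2 * norm v"
        by (rule order_trans[OF abs_triangle_ineq4 add_mono[OF 1 2]])
      finally show "\<bar>defect t (Q s) v + defect' t (\<phi> t) v\<bar> \<le> e * norm v" by simp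
    qed
  qed
  have "cauchy_filter (filtermap Q (at t))"
    unfolding cauchy_filter_metric_filtermap
  proof (intro allI impI)
    fix e :: real assume "e > 0"
    then have e: "d * e / 4 > 0" using d by simp
    define P where "P s \<longleftrightarrow> (\<forall>v. \<bar>defect t (Q s) v + defect' t (\<phi> t) v\<bar> \<le> d * e / 4 * norm v) \<and> b t (\<phi> t) (Q s) = 0" for s
    have "\<forall>\<^sub>F s in at t. b t (\<phi> t) (Q s) = 0"
      using eventually_overlap_nonzero[OF t]
      by eventually_elim (simp add: Q_def b.scaleR_right b.diff_right overlap_aligned aligned_self eigen t)
    then have "eventually P (at t)" unfolding P_def using approx[OF e] by eventually_elim auto
    moreover have "dist (Q r) (Q s) < e" if "P r" "P s" for r s
    proof -
      define v where "v = Q r - Q s"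
      have "b t (\<phi> t) v = 0" using that by (simp add: P_def v_def b.diff_right)
      then have "d * (norm v)\<^sup>2 \<le> defect t v v" by (rule d)
      also have "\<dots> = (defect t (Q r) v + defect' t (\<phi> t) v) - (defect t (Q s) v + defect' t (\<phi> t) v)"
        by (subst v_def) (simp add: L.diff_left)
      also have "\<dots> \<le> d * e / 4 * norm v + d * e / 4 * norm v"
        using that unfolding P_def abs_le_iff by (smt (verit))
      finally have "d * ((norm v)\<^sup>2) \<le> d * (e / 2 * norm v)" by simp
      then have "norm v * norm v \<le> e / 2 * norm v" using d by (simp add: power2_eq_square)
      then have "norm v \<le> e / 2 \<or> norm v = 0" by (metis mult_right_le_imp_le norm_ge_zero order_le_less)
      then show ?thesis using \<open>e > 0\<close> by (auto simp: v_def dist_norm)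
    qed
    ultimately show "\<exists>P. eventually P (at t) \<and> (\<forall>x y. P x \<and> P y \<longrightarrow> dist (Q x) (Q y) < e)" by blast
  qed
  moreover have "filtermap Q (at t) \<noteq> bot" by (simp add: filtermap_bot_iff)
  ultimately obtain z where "filtermap Q (at t) \<le> nhds z"
    using cauchy_filter_complete_converges[OF _ complete_UNIV] by (metis principal_UNIV top_greatest)
  then have "(aligned t has_vector_derivative z) (at t)"
    by (simp add: has_vector_derivative_iff_quotient filterlim_def Q_def[abs_def])
  then show thesis by (rule that)
qed

text \<open>
  The right-hand side is homogeneous of degree \<open>0\<close> in the eigenfunction, hence insensitive to its sign
  and scale; unlike \<open>\<phi>\<close>, \<open>aligned t\<close> is differentiable at \<open>t\<close>.
\<close>

lemma lam'_eq_aligned: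
  assumes s: "s \<in> I" and "overlap t s \<noteq> 0"
  shows "lam' s = (a' s (aligned t s) (aligned t s) - lam s * b' s (aligned t s) (aligned t s)) / b s (aligned t s) (aligned t s)"
proof -
  interpret a': bounded_bilinear "a' s" using s by (rule bilinear)
  interpret b: bounded_bilinear "b s" using s by (rule bilinear)
  interpret b': bounded_bilinear "b' s" using s by (rule bilinear)
  show ?thesis
    using assms by (simp add: aligned_def lam'_def a'.scaleR_left a'.scaleR_right b'.scaleR_left b'.scaleR_right
        b.scaleR_left b.scaleR_right eigen field_simps)
qed

lemma DERIV_lam':
  assumes t: "t \<in> I"
  obtains lam'' where "(lam' has_real_derivative lam'') (at t)"
proof -
  obtain z where z: "(aligned t has_vector_derivative z) (at t)" using aligned_differentiable[OF t] .
  note D = form_has_derivative_DERIV_apply[OF _ _ _ z z]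
  obtain n where n: "((\<lambda>s. a' s (aligned t s) (aligned t s) - lam s * b' s (aligned t s) (aligned t s)) has_real_derivative n) (at t)"
    using DERIV_diff[OF D[OF derivative(2) bilinear(2,3)] DERIV_mult[OF DERIV_eigenvalue D[OF derivative(4) bilinear(5,6)]]] t
    by blast
  have "b t (aligned t t) (aligned t t) \<noteq> 0" using t by (simp add: aligned_self eigen)
  from DERIV_divide[OF n D[OF derivative(3) bilinear(4,5)] this]
  obtain k where k: "((\<lambda>s. (a' s (aligned t s) (aligned t s) - lam s * b' s (aligned t s) (aligned t s)) / b s (aligned t s) (aligned t s))
      has_real_derivative k) (at t)" using t by blast
  have "overlap t t \<noteq> 0" using t by (simp add: overlap_def eigen)
  then have "\<forall>\<^sub>F s in nhds t. overlap t s \<noteq> 0"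
    using eventually_overlap_nonzero[OF t] by (auto simp: eventually_at_filter elim: eventually_mono)
  moreover have "\<forall>\<^sub>F s in nhds t. s \<in> I" using open_I t by (rule eventually_nhds_in_open)
  ultimately have "\<forall>\<^sub>F s in nhds t. lam' s =
      (a' s (aligned t s) (aligned t s) - lam s * b' s (aligned t s) (aligned t s)) / b s (aligned t s) (aligned t s)"
    by eventually_elim (rule lam'_eq_aligned)
  then have "(lam' has_real_derivative k) (at t)" using k by (subst DERIV_cong_ev) auto
  then show thesis by (rule that)
qed

text \<open>
  With \<open>\<phi> t\<close> frozen, \<open>defect s (\<phi> t) (\<phi> t)\<close> is nonnegative for \<open>s\<close> near \<open>t\<close> and zero at \<open>s = t\<close>. Its second
  derivative at this minimum is the difference of the two sides.
\<close>

lemma second_derivative_le: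
  assumes t: "t \<in> I" and lam'': "(lam' has_real_derivative lam'') (at t)"
  shows "lam'' \<le> a'' t (\<phi> t) (\<phi> t) - lam t * b'' t (\<phi> t) (\<phi> t) - 2 * lam' t * b' t (\<phi> t) (\<phi> t)"
proof -
  note D = form_has_derivative_imp_DERIV
  have "0 \<le> a'' t (\<phi> t) (\<phi> t) - (lam'' * b t (\<phi> t) (\<phi> t) + b' t (\<phi> t) (\<phi> t) * lam' t +
      (lam' t * b' t (\<phi> t) (\<phi> t) + b'' t (\<phi> t) (\<phi> t) * lam t))"
  proof (rule second_derivative_nonneg_at_local_min)
    show "\<forall>\<^sub>F s in nhds t. ((\<lambda>s. defect s (\<phi> t) (\<phi> t)) has_real_derivative defect' s (\<phi> t) (\<phi> t)) (at s)"
      using eventually_nhds_in_open[OF open_I t]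
      by eventually_elim (rule D[OF defect_has_derivative bounded_bilinear_defect bounded_bilinear_defect'])
    show "((\<lambda>s. defect' s (\<phi> t) (\<phi> t)) has_real_derivative
        a'' t (\<phi> t) (\<phi> t) - (lam'' * b t (\<phi> t) (\<phi> t) + b' t (\<phi> t) (\<phi> t) * lam' t +
      (lam' t * b' t (\<phi> t) (\<phi> t) + b'' t (\<phi> t) (\<phi> t) * lam t))) (at t)"
      unfolding defect'_def using t
      by (intro DERIV_diff DERIV_add DERIV_mult lam'' DERIV_eigenvalue D[OF derivative(2) bilinear(2,3)]
          D[OF derivative(3) bilinear(4,5)] D[OF derivative(4) bilinear(5,6)])
    show "\<forall>\<^sub>F s in nhds t. defect t (\<phi> t) (\<phi> t) \<le> defect s (\<phi> t) (\<phi> t)"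
      using eventually_nhds_in_open[OF open_I t]
      by eventually_elim (use rayleigh_lower_bound t in \<open>simp add: defect_eigenfunction\<close>, simp add: defect_def rayleigh_lower_bound)
  qed
  then show ?thesis using t by (simp add: eigen algebra_simps)
qed

lemma eigenvalue_second_order:
  assumes t: "t \<in> I"
  shows "lam differentiable (at t)" "deriv lam differentiable (at t)" "deriv lam t = lam' t"
    "deriv (deriv lam) t \<le> a'' t (\<phi> t) (\<phi> t) - lam t * b'' t (\<phi> t) (\<phi> t) - 2 * lam' t * b' t (\<phi> t) (\<phi> t)"
proof -
  have d1: "deriv lam s = lam' s" if "s \<in> I" for s using DERIV_eigenvalue[OF that] by (rule DERIV_imp_deriv)
  show "lam differentiable (at t)" using DERIV_eigenvalue[OF t] by (auto simp: real_differentiable_def)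
  show "deriv lam t = lam' t" using t by (rule d1)
  obtain k where k: "(lam' has_real_derivative k) (at t)" using DERIV_lam'[OF t] .
  have "\<forall>\<^sub>F s in nhds t. deriv lam s = lam' s"
    using eventually_nhds_in_open[OF open_I t] by eventually_elim (rule d1)
  then have k': "(deriv lam has_real_derivative k) (at t)" using k by (subst DERIV_cong_ev) auto
  then show "deriv lam differentiable (at t)" by (auto simp: real_differentiable_def)
  show "deriv (deriv lam) t \<le> a'' t (\<phi> t) (\<phi> t) - lam t * b'' t (\<phi> t) (\<phi> t) - 2 * lam' t * b' t (\<phi> t) (\<phi> t)"
    using second_derivative_le[OF t k] DERIV_imp_deriv[OF k'] by simp
qed

end

section \<open>The lowest eigenvalue of a differentiable family of forms\<close>

theorem theorem1:
  fixes \<iota> :: "'v::{real_inner,complete_space} \<Rightarrow> 'x::{real_inner,complete_space}"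
    and \<epsilon>\<^sub>0 :: real
    and A A' A'' :: "real \<Rightarrow> 'v \<Rightarrow> 'v \<Rightarrow> real"
    and B B' B'' :: "real \<Rightarrow> 'x \<Rightarrow> 'x \<Rightarrow> real"
    and lam :: "nat \<Rightarrow> real \<Rightarrow> real"
    and u :: "nat \<Rightarrow> real \<Rightarrow> 'v"
  defines "I \<equiv> {-\<epsilon>\<^sub>0<..<\<epsilon>\<^sub>0}"
  assumes "\<epsilon>\<^sub>0 > 0"
    and "compact_embedding \<iota>"
    and "closure (range \<iota>) = UNIV"
    and "infinite_dimensional TYPE('v)"
    and "symmetric_coercive_family I A"
    and "symmetric_coercive_family I B"
    and "twice_differentiable_family I A A' A''"
    and "twice_differentiable_family I B B' B''"
    and "\<And>t. t \<in> I \<Longrightarrow> eigensystem \<iota> (A t) (B t) (\<lambda>n. lam n t) (\<lambda>n. u n t)"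
    and "\<And>t. t \<in> I \<Longrightarrow> lam 0 t < lam 1 t"
  shows "\<forall>t\<in>I.
    lam 0 differentiable (at t) \<and> deriv (lam 0) differentiable (at t) \<and>
    (let \<phi> = u 0 t; \<mu> = lam 0 t; \<mu>' = deriv (lam 0) t; \<mu>'' = deriv (deriv (lam 0)) t
     in \<mu>' = A' t \<phi> \<phi> - \<mu> * B' t (\<iota> \<phi>) (\<iota> \<phi>) \<and>
        \<mu>'' \<le> A'' t \<phi> \<phi> - \<mu> * B'' t (\<iota> \<phi>) (\<iota> \<phi>) - 2 * \<mu>' * B' t (\<iota> \<phi>) (\<iota> \<phi>))"
proof -
  have I: "open I" by (simp add: I_def)
  have \<iota>: "bounded_linear \<iota>" using \<open>compact_embedding \<iota>\<close> by (simp add: compact_embedding_def)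
  note A = \<open>symmetric_coercive_family I A\<close> and B = \<open>symmetric_coercive_family I B\<close>
  note A2 = \<open>twice_differentiable_family I A A' A''\<close> and B2 = \<open>twice_differentiable_family I B B' B''\<close>
  note bilA = symmetric_coercive_family_bounded_bilinear[OF A]
  note bilB = symmetric_coercive_family_bounded_bilinear[OF B]
  have symA: "A t v w = A t w v" and symB: "B t x y = B t y x" if "t \<in> I" for t v w x y
    using A B that by (auto simp: symmetric_coercive_family_def)
  obtain \<delta> where \<delta>: "\<delta> > 0" "\<And>t v. t \<in> I \<Longrightarrow> \<delta> * (norm v)\<^sup>2 \<le> A t v v"
    using A unfolding symmetric_coercive_family_def by blast
  have posB: "0 \<le> B t x x" if "t \<in> I" for t x
    using B that unfolding symmetric_coercive_family_def
    by (meson order_trans mult_nonneg_nonneg less_imp_le zero_le_power2)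
  note es = \<open>\<And>t. t \<in> I \<Longrightarrow> eigensystem \<iota> (A t) (B t) (\<lambda>n. lam n t) (\<lambda>n. u n t)\<close>
  have eig: "A t (u 0 t) v = lam 0 t * B t (\<iota> (u 0 t)) (\<iota> v)" "B t (\<iota> (u 0 t)) (\<iota> (u 0 t)) = 1"
    if "t \<in> I" for t v
    using es[OF that] by (auto simp: eigensystem_def normalized_eigenpair_def)
  note pull = bounded_bilinear.comp[OF _ \<iota> \<iota>]
  note bilA2 = twice_differentiable_family_bounded_bilinear[OF A2]
    and bilB2 = twice_differentiable_family_bounded_bilinear[OF B2]
  note derivA = twice_differentiable_family_form_has_derivative[OF A2 I _ bilA]
      twice_differentiable_family_form_has_second_derivative[OF A2 I _ bilA]
    and derivB = twice_differentiable_family_form_has_derivative[OF B2 I _ bilB]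
      twice_differentiable_family_form_has_second_derivative[OF B2 I _ bilB]
  interpret simple_lowest_eigenvalue I A A' A'' "\<lambda>t v w. B t (\<iota> v) (\<iota> w)"
    "\<lambda>t v w. B' t (\<iota> v) (\<iota> w)" "\<lambda>t v w. B'' t (\<iota> v) (\<iota> w)" "lam 0" "u 0" \<delta>
  proof (rule simple_lowest_eigenvalue.intro)
    fix t assume t: "t \<in> I"
    show "\<exists>c>0. \<forall>v. B t (\<iota> (u 0 t)) (\<iota> v) = 0 \<longrightarrow>
        c * (norm v)\<^sup>2 \<le> A t v v - lam 0 t * B t (\<iota> v) (\<iota> v)"
      using eigensystem_spectral_gap[OF es[OF t] assms(11)[OF t] \<iota> bilA[OF t] symA[OF t] \<delta>(2)[OF t]
          bilB[OF t] symB[OF t] posB[OF t] \<delta>(1)] .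
  qed (rule I symA symB \<delta> eig bilA bilB[THEN pull] bilA2 bilB2[THEN pull] derivA
      derivB[THEN form_has_derivative_pullback, OF _ _ \<iota>] | assumption)+
  show ?thesis
    using eigenvalue_second_order by (simp add: Let_def lam'_def)
qed

end
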